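(* Let $\mathbf{u}\in\{0,1\}^{\mathbb{N}}$ be a Sturmian sequence fixed by a primitive morphism $\varphi\in\mathcal{M}$. Then the square root $\sqrt{\mathbf{u}}$ is fixed by a morphism $\psi\in\mathcal{M}$ which is a conjugate of one of the morphisms $\varphi,\varphi^2,\varphi^3$ or $\varphi^4$.
   Context: Sturmian sequences: for irrational $\alpha\in(0,1)$ and real $\delta$, the lower and upper Sturmian sequences with slope $\alpha$ and intercept $\delta$ are $\mathbf{s}_{\alpha,\delta}(n)=\lfloor\alpha(n+1)+\delta\rfloor-\lfloor\alpha n+\delta\rfloor$ and $\mathbf{s}'_{\alpha,\delta}(n)=\lceil\alpha(n+1)+\delta\rceil-\lceil\alpha n+\delta\rceil$, $n\in\mathbb{N}=\{0,1,2,\dots\}$. A Sturmian sequence is any sequence of one of these forms. Morphisms: a morphism is a monoid endomorphism of $\{0,1\}^*$, extended to infinite sequences letter by letter; it fixes $\mathbf{u}$ if $\varphi(\mathbf{u})=\mathbf{u}$. It is primitive if there is $k$ such that every letter $a$ occurs in $\varphi^k(b)$ for all letters $b$. The special Sturmian monoid $\mathcal{M}=\langle G,\widetilde G,D,\widetilde D\rangle$ is generated under composition by $G:0\mapsto 0,\,1\mapsto 01$; $\widetilde G:0\mapsto 0,\,1\mapsto 10$; $D:0\mapsto 10,\,1\mapsto 1$; $\widetilde D:0\mapsto 01,\,1\mapsto 1$. Conjugacy: $\varphi$ is a right conjugate of $\psi$ (and $\psi$ a left conjugate of $\varphi$) if there is a word $w\in\{0,1\}^*$ with $w\psi(a)=\varphi(a)w$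 for every letter $a$. Two morphisms are conjugate if one of them is a right or left conjugate of the other. Square root: by a known result of Saari, every Sturmian sequence $\mathbf{u}$ can be written as $\mathbf{u}=X_1^2X_2^2X_3^2\cdots$ where, for each $k$, $X_k$ is a nonempty word and $X_k^2$ is the shortest nonempty square prefix of the sequence $X_k^2X_{k+1}^2X_{k+2}^2\cdots$ (and only six distinct words occur among the $X_k$). The square root of $\mathbf{u}$ is $\sqrt{\mathbf{u}}=X_1X_2X_3\cdots$. Known theorem (Peltomäki–Whiteland): if $\mathbf{u}$ is Sturmian with slope $\alpha$ and intercept $\delta$, then $\sqrt{\mathbf{u}}$ is Sturmian with slope $\alpha$ and intercept $\frac{1-\alpha+\delta}{2}$ (here $\delta\in[0,1)$ for lower sequences, $\delta\in(0,1]$ for upper ones). *)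

theory Defs
  imports Complex_Main "HOL-Library.Stream"
begin

text \<open>The letters 0 and 1 are \<^const>\<open>False\<close> and \<^const>\<open>True\<close>, so that \<^const>\<open>of_bool\<close>
  sends a letter to its numerical value; finite words are lists, infinite sequences are streams.\<close>

definition lower_sturmian :: "real \<Rightarrow> real \<Rightarrow> nat \<Rightarrow> int" where
  "lower_sturmian \<alpha> \<delta> n = \<lfloor>\<alpha> * (real n + 1) + \<delta>\<rfloor> - \<lfloor>\<alpha> * real n + \<delta>\<rfloor>"

definition upper_sturmian :: "real \<Rightarrow> real \<Rightarrow> nat \<Rightarrow> int" where
  "upper_sturmian \<alpha> \<delta> n = \<lceil>\<alpha> * (real n + 1) + \<delta>\<rceil> - \<lceil>\<alpha> * real n + \<delta>\<rceil>"

definition sturmian :: "bool stream \<Rightarrow> bool" where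
  "sturmian u \<longleftrightarrow> (\<exists>\<alpha> \<delta> :: real. 0 < \<alpha> \<and> \<alpha> < 1 \<and> \<alpha> \<notin> \<rat> \<and>
     ((\<forall>n. of_bool (u !! n) = lower_sturmian \<alpha> \<delta> n) \<or>
      (\<forall>n. of_bool (u !! n) = upper_sturmian \<alpha> \<delta> n)))"


definition morphism :: "bool list \<Rightarrow> bool list \<Rightarrow> bool list \<Rightarrow> bool list" where
  "morphism x y w = concat (map (\<lambda>a. if a then y else x) w)"

definition morph_G :: "bool list \<Rightarrow> bool list" where
  "morph_G = morphism [False] [False, True]"

definition morph_G' :: "bool list \<Rightarrow> bool list" where
  "morph_G' = morphism [False] [True, False]"

definition morph_D :: "bool list \<Rightarrow> bool list" where
  "morph_D = morphism [True, False] [True]"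

definition morph_D' :: "bool list \<Rightarrow> bool list" where
  "morph_D' = morphism [False, True] [True]"

inductive_set special_sturmian_monoid :: "(bool list \<Rightarrow> bool list) set" where
  id: "id \<in> special_sturmian_monoid"
| G: "morph_G \<in> special_sturmian_monoid"
| G': "morph_G' \<in> special_sturmian_monoid"
| D: "morph_D \<in> special_sturmian_monoid"
| D': "morph_D' \<in> special_sturmian_monoid"
| comp: "\<phi> \<in> special_sturmian_monoid \<Longrightarrow> \<psi> \<in> special_sturmian_monoid \<Longrightarrow>
    \<phi> \<circ> \<psi> \<in> special_sturmian_monoid"

text \<open>The letter-by-letter extension of a morphism to infinite sequences. Since \<^const>\<open>flat\<close>
  concatenates nonempty words only, this is meaningful for nonerasing morphisms, in particular
  for all elements of \<^const>\<open>special_sturmian_monoid\<close>.\<close>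

definition morph_stream :: "(bool list \<Rightarrow> bool list) \<Rightarrow> bool stream \<Rightarrow> bool stream" where
  "morph_stream \<phi> u = flat (smap (\<lambda>a. \<phi> [a]) u)"

definition fixes_seq :: "(bool list \<Rightarrow> bool list) \<Rightarrow> bool stream \<Rightarrow> bool" where
  "fixes_seq \<phi> u \<longleftrightarrow> morph_stream \<phi> u = u"

definition primitive_morphism :: "(bool list \<Rightarrow> bool list) \<Rightarrow> bool" where
  "primitive_morphism \<phi> \<longleftrightarrow> (\<exists>k. \<forall>a b. a \<in> set ((\<phi> ^^ k) [b]))"

definition right_conjugate :: "(bool list \<Rightarrow> bool list) \<Rightarrow> (bool list \<Rightarrow> bool list) \<Rightarrow> bool" where
  "right_conjugate \<phi> \<psi> \<longleftrightarrow> (\<exists>w. \<forall>a. w @ \<psi> [a] = \<phi> [a] @ w)"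

definition conjugate :: "(bool list \<Rightarrow> bool list) \<Rightarrow> (bool list \<Rightarrow> bool list) \<Rightarrow> bool" where
  "conjugate \<phi> \<psi> \<longleftrightarrow> right_conjugate \<phi> \<psi> \<or> right_conjugate \<psi> \<phi>"


definition square_prefix :: "bool list \<Rightarrow> bool stream \<Rightarrow> bool" where
  "square_prefix x u \<longleftrightarrow> x \<noteq> [] \<and> stake (length (x @ x)) u = x @ x"

definition shortest_square_prefix :: "bool list \<Rightarrow> bool stream \<Rightarrow> bool" where
  "shortest_square_prefix x u \<longleftrightarrow>
     square_prefix x u \<and> (\<forall>y. square_prefix y u \<longrightarrow> length x \<le> length y)"

definition square_product :: "bool list stream \<Rightarrow> bool stream" where
  "square_product X = flat (smap (\<lambda>x. x @ x) X)"

definition square_factorization :: "bool stream \<Rightarrow> bool list stream \<Rightarrow> bool" where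
  "square_factorization u X \<longleftrightarrow>
     (\<forall>k. X !! k \<noteq> []) \<and> u = square_product X \<and>
     (\<forall>k. shortest_square_prefix (X !! k) (square_product (sdrop k X)))"

text \<open>There is at most one such factorization, as each of its words is determined by the ones
  before it; for Sturmian sequences it exists by a theorem of Saari.\<close>

definition square_root :: "bool stream \<Rightarrow> bool stream" where
  "square_root u = flat (THE X. square_factorization u X)"

end

theory Submission
  imports Defs "HOL-Analysis.Kronecker_Approximation_Theorem"
begin

text \<open>
  Put the breakpoint of the rotation coded by a Sturmian sequence at 0, so that the sequence codes
  the orbit of a point \<open>z\<close> of \<open>[-\<beta>, \<alpha>)\<close> under the exchange of \<open>[-\<beta>, 0)\<close> and \<open>[0, \<alpha>)\<close>, where
  \<open>\<beta> = 1 - \<alpha>\<close>. In this coordinate the square root is the map \<open>z \<mapsto> z / 2\<close>. An element \<open>\<phi>\<close> of the special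
  Sturmian monoid maps \<open>(\<alpha>, \<beta>, z)\<close> to \<open>(\<alpha>', \<beta>', z + t)\<close> with \<open>t\<close> in the lattice spanned by \<open>\<alpha>'\<close> and \<open>\<beta>'\<close>;
  it is conjugate to a product \<open>\<theta>\<close> with \<open>t = 0\<close>, and every morphism between \<open>\<theta>\<close> and \<open>\<phi>\<close> in the
  conjugacy class belongs to the monoid again. If \<open>\<phi>\<close> fixes the coding of \<open>z\<close>, then the translation of
  \<open>\<phi>\<^sup>3\<close> or of \<open>\<phi>\<^sup>4\<close> is twice a lattice element, and the conjugate halfway between \<open>\<theta>\<^sup>n\<close> and \<open>\<phi>\<^sup>n\<close> fixes
  the coding of \<open>z / 2\<close>.
\<close>


section \<open>Streams and morphisms\<close>

lemma stream_eqI: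
  assumes "\<And>n. x !! n = y !! n"
  shows "x = y"
  using assms smap_alt[of id x y] by (simp add: stream.map_id)

text \<open>Stripping a nonempty common prefix strictly lowers the position that is inspected, so
  strong induction on the position applies. Images under morphisms and square products are handled
  this way, one block at a time.\<close>

lemma shift_coinduct:
  assumes "R x y"
    and step: "\<And>x y. R x y \<Longrightarrow> \<exists>w x' y'. w \<noteq> [] \<and> x = w @- x' \<and> y = w @- y' \<and> R x' y'"
  shows "x = y"
proof (rule stream_eqI)
  fix n
  from \<open>R x y\<close> show "x !! n = y !! n"
  proof (induction n arbitrary: x y rule: less_induct)
    case (less n)
    from step[OF less.prems] obtain w x' y' where
      w: "w \<noteq> []" "x = w @- x'" "y = w @- y'" "R x' y'" by blast
    show ?case
    proof (cases "n < length w")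
      case True
      then show ?thesis using w by simp
    next
      case False
      moreover have "0 < length w" using w(1) by simp
      ultimately have "n - length w < n" by linarith
      from less.IH[OF this w(4)] show ?thesis using w False by simp
    qed
  qed
qed

definition nonerasing_hom :: "(bool list \<Rightarrow> bool list) \<Rightarrow> bool" where
  "nonerasing_hom \<phi> \<longleftrightarrow> (\<forall>x y. \<phi> (x @ y) = \<phi> x @ \<phi> y) \<and> (\<forall>a. \<phi> [a] \<noteq> [])"

lemma hom_append: "nonerasing_hom \<phi> \<Longrightarrow> \<phi> (x @ y) = \<phi> x @ \<phi> y"
  by (simp add: nonerasing_hom_def)

lemma hom_Nil: "nonerasing_hom \<phi> \<Longrightarrow> \<phi> [] = []"
  using hom_append[of \<phi> "[]" "[]"] by simp

lemma hom_Cons: "nonerasing_hom \<phi> \<Longrightarrow> \<phi> (a # x) = \<phi> [a] @ \<phi> x"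
  using hom_append[of \<phi> "[a]" x] by simp

lemma hom_letter: "nonerasing_hom \<phi> \<Longrightarrow> \<phi> [a] \<noteq> []"
  by (simp add: nonerasing_hom_def)

lemma hom_eq_Nil_iff:
  assumes "nonerasing_hom \<phi>"
  shows "\<phi> x = [] \<longleftrightarrow> x = []"
proof (cases x)
  case (Cons a y)
  have "\<phi> (a # y) \<noteq> []"
    unfolding hom_Cons[OF assms, of a y] using hom_letter[OF assms] by blast
  then show ?thesis using Cons by simp
qed (simp add: hom_Nil[OF assms])

lemma hom_morphism: "x \<noteq> [] \<Longrightarrow> y \<noteq> [] \<Longrightarrow> nonerasing_hom (morphism x y)"
  by (simp add: nonerasing_hom_def morphism_def)

lemma hom_comp: "nonerasing_hom \<phi> \<Longrightarrow> nonerasing_hom \<psi> \<Longrightarrow> nonerasing_hom (\<phi> \<circ> \<psi>)"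
  unfolding nonerasing_hom_def using hom_eq_Nil_iff[unfolded nonerasing_hom_def] by auto

lemma hom_special: "\<phi> \<in> special_sturmian_monoid \<Longrightarrow> nonerasing_hom \<phi>"
proof (induction rule: special_sturmian_monoid.induct)
  case id
  show ?case by (simp add: nonerasing_hom_def)
next
  case (comp \<phi> \<psi>)
  then show ?case by (intro hom_comp)
qed (simp_all add: morph_G_def morph_G'_def morph_D_def morph_D'_def hom_morphism)

lemma funpow_special: "\<phi> \<in> special_sturmian_monoid \<Longrightarrow> \<phi> ^^ n \<in> special_sturmian_monoid"
  by (induction n) (auto intro: special_sturmian_monoid.intros)

lemma morph_stream_Stream:
  "nonerasing_hom \<phi> \<Longrightarrow> morph_stream \<phi> (a ## s) = \<phi> [a] @- morph_stream \<phi> s"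
  by (simp add: morph_stream_def hom_letter)

lemma morph_stream_shift:
  "nonerasing_hom \<phi> \<Longrightarrow> morph_stream \<phi> (w @- s) = \<phi> w @- morph_stream \<phi> s"
proof (induction w)
  case (Cons a w)
  then show ?case using hom_Cons[of \<phi> a w] by (simp add: morph_stream_Stream)
qed (simp add: hom_Nil)

lemma morph_stream_comp:
  assumes "nonerasing_hom \<phi>" "nonerasing_hom \<psi>"
  shows "morph_stream (\<phi> \<circ> \<psi>) s = morph_stream \<phi> (morph_stream \<psi> s)"
proof (rule shift_coinduct[where R = "\<lambda>x y. \<exists>s. x = morph_stream (\<phi> \<circ> \<psi>) s \<and> y = morph_stream \<phi> (morph_stream \<psi> s)"])
  fix x y assume "\<exists>s. x = morph_stream (\<phi> \<circ> \<psi>) s \<and> y = morph_stream \<phi> (morph_stream \<psi> s)"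
  then obtain s where s: "x = morph_stream (\<phi> \<circ> \<psi>) s" "y = morph_stream \<phi> (morph_stream \<psi> s)" by blast
  obtain a t where t: "s = a ## t" by (cases s)
  have "x = \<phi> (\<psi> [a]) @- morph_stream (\<phi> \<circ> \<psi>) t"
    using s t morph_stream_Stream[OF hom_comp[OF assms]] by simp
  moreover have "y = \<phi> (\<psi> [a]) @- morph_stream \<phi> (morph_stream \<psi> t)"
    using s t assms by (simp add: morph_stream_Stream morph_stream_shift)
  moreover have "\<phi> (\<psi> [a]) \<noteq> []" using assms by (simp add: hom_eq_Nil_iff hom_letter)
  ultimately show "\<exists>w x' y'. w \<noteq> [] \<and> x = w @- x' \<and> y = w @- y' \<and>
      (\<exists>s. x' = morph_stream (\<phi> \<circ> \<psi>) s \<and> y' = morph_stream \<phi> (morph_stream \<psi> s))" by blast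
qed blast

lemma morph_stream_id: "morph_stream id s = s"
proof (rule shift_coinduct[where R = "\<lambda>x y. x = morph_stream id y"])
  fix x y :: "bool stream" assume *: "x = morph_stream id y"
  obtain a t where t: "y = a ## t" by (cases y)
  have "x = [a] @- morph_stream id t" "y = [a] @- t"
    using * t by (simp_all add: morph_stream_def)
  then show "\<exists>w x' y'. w \<noteq> [] \<and> x = w @- x' \<and> y = w @- y' \<and> x' = morph_stream id y'" by blast
qed simp

lemma morph_stream_funpow_fixed:
  assumes "\<phi> \<in> special_sturmian_monoid" "morph_stream \<phi> u = u"
  shows "morph_stream (\<phi> ^^ n) u = u"
proof (induction n)
  case (Suc n)
  have "morph_stream (\<phi> \<circ> \<phi> ^^ n) u = morph_stream \<phi> (morph_stream (\<phi> ^^ n) u)"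
    by (intro morph_stream_comp hom_special funpow_special assms)
  then show ?case using Suc assms by (simp only: funpow.simps)
qed (simp add: morph_stream_id[unfolded id_def])

section \<open>Conjugate morphisms on words, streams and powers\<close>

lemma conjugation_words:
  assumes "nonerasing_hom \<phi>" "nonerasing_hom \<psi>" "\<And>a. w @ \<psi> [a] = \<phi> [a] @ w"
  shows "w @ \<psi> x = \<phi> x @ w"
proof (induction x)
  case (Cons a x)
  have "w @ \<psi> (a # x) = (w @ \<psi> [a]) @ \<psi> x"
    using hom_Cons[OF assms(2), of a x] by simp
  also have "\<dots> = \<phi> [a] @ (w @ \<psi> x)" by (simp add: assms(3))
  also have "\<dots> = \<phi> (a # x) @ w" using Cons.IH hom_Cons[OF assms(1), of a x] by simp
  finally show ?case .
qed (simp add: assms hom_Nil)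

text \<open>The word \<open>w\<close> is pushed to the right past one image
  \<open>\<phi> [a]\<close> after the other and never comes back. Hence the left conjugate
  \<open>\<psi>\<close> gives the same sequence without the prefix \<open>w\<close>.\<close>

lemma conjugation_stream:
  assumes "nonerasing_hom \<phi>" "nonerasing_hom \<psi>" "\<And>a. w @ \<psi> [a] = \<phi> [a] @ w"
  shows "w @- morph_stream \<psi> s = morph_stream \<phi> s"
proof (rule shift_coinduct[where R = "\<lambda>x y. \<exists>s. x = w @- morph_stream \<psi> s \<and> y = morph_stream \<phi> s"])
  fix x y assume "\<exists>s. x = w @- morph_stream \<psi> s \<and> y = morph_stream \<phi> s"
  then obtain s where s: "x = w @- morph_stream \<psi> s" "y = morph_stream \<phi> s" by blast
  obtain a t where t: "s = a ## t" by (cases s)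
  have "x = (w @ \<psi> [a]) @- morph_stream \<psi> t"
    using s t assms(2) by (simp add: morph_stream_Stream)
  then have "x = \<phi> [a] @- (w @- morph_stream \<psi> t)"
    unfolding assms(3) by simp
  moreover have "y = \<phi> [a] @- morph_stream \<phi> t"
    using s t assms by (simp add: morph_stream_Stream)
  ultimately show "\<exists>v x' y'. v \<noteq> [] \<and> x = v @- x' \<and> y = v @- y' \<and>
      (\<exists>s. x' = w @- morph_stream \<psi> s \<and> y' = morph_stream \<phi> s)"
    using hom_letter[OF assms(1)] by blast
qed blast

text \<open>If \<open>v\<close> conjugates the n-th powers, then \<open>\<phi> v @ w\<close>
  conjugates the next ones.\<close>

lemma conjugation_funpow:
  assumes "nonerasing_hom \<phi>" "\<And>x. w @ \<psi> x = \<phi> x @ w"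
  shows "\<exists>v. \<forall>x. v @ (\<psi> ^^ n) x = (\<phi> ^^ n) x @ v"
proof (induction n)
  case (Suc n)
  then obtain v where v: "\<And>x. v @ (\<psi> ^^ n) x = (\<phi> ^^ n) x @ v" by blast
  have "(\<phi> v @ w) @ (\<psi> ^^ Suc n) x = (\<phi> ^^ Suc n) x @ (\<phi> v @ w)" for x
  proof -
    have "(\<phi> v @ w) @ (\<psi> ^^ Suc n) x = \<phi> v @ \<phi> ((\<psi> ^^ n) x) @ w"
      using assms(2) by simp
    also have "\<dots> = \<phi> (v @ (\<psi> ^^ n) x) @ w" using hom_append[OF assms(1)] by simp
    also have "\<dots> = \<phi> ((\<phi> ^^ n) x @ v) @ w" using v by simp
    also have "\<dots> = (\<phi> ^^ Suc n) x @ (\<phi> v @ w)" using hom_append[OF assms(1)] by simp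
    finally show ?thesis .
  qed
  then show ?case by blast
qed (auto intro: exI[of _ "[]"])


section \<open>Conjugates inside the special Sturmian monoid\<close>

lemma generators_words:
  "False # morph_G' x = morph_G x @ [False]"
  "True # morph_D' x = morph_D x @ [True]"
proof -
  show "False # morph_G' x = morph_G x @ [False]"
    by (induction x) (simp_all add: morph_G_def morph_G'_def morphism_def)
  show "True # morph_D' x = morph_D x @ [True]"
    by (induction x) (simp_all add: morph_D_def morph_D'_def morphism_def)
qed

text \<open>One step of left conjugation: a common first letter \<open>c\<close> of all images moves
  to their ends. The condition is vacuous when the images begin with different letters.\<close>

definition left_shiftable :: "(bool list \<Rightarrow> bool list) \<Rightarrow> bool" where
  "left_shiftable \<phi> \<longleftrightarrow> (\<forall>c. (\<forall>a. hd (\<phi> [a]) = c) \<longrightarrow>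
     (\<exists>\<psi> \<in> special_sturmian_monoid. \<forall>a. c # \<psi> [a] = \<phi> [a] @ [c]))"

text \<open>For \<open>g\<close> = G or D all nonempty images begin with \<open>d\<close>, so
  \<open>c\<close> can only be \<open>d\<close>, and the shift turns \<open>g\<close> into its left
  conjugate \<open>h\<close> whatever \<open>\<eta>\<close> is.\<close>

lemma left_shiftable_G_D:
  assumes chi: "\<eta> \<in> special_sturmian_monoid"
  assumes g: "\<And>x. d # h x = g x @ [d]" "\<And>x. x \<noteq> [] \<Longrightarrow> hd (g x) = d" "h \<in> special_sturmian_monoid"
  shows "left_shiftable (g \<circ> \<eta>)"
  unfolding left_shiftable_def
proof (intro allI impI)
  fix c assume "\<forall>a. hd ((g \<circ> \<eta>) [a]) = c"
  then have "c = d" using g(2)[of "\<eta> [False]"] hom_letter[OF hom_special[OF chi]] by auto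
  then have "\<forall>a. c # (h \<circ> \<eta>) [a] = (g \<circ> \<eta>) [a] @ [c]" using g(1) by simp
  then show "\<exists>\<psi>\<in>special_sturmian_monoid. \<forall>a. c # \<psi> [a] = (g \<circ> \<eta>) [a] @ [c]"
    using special_sturmian_monoid.comp[OF g(3) chi] by blast
qed

text \<open>The two cases below correspond to whether the inner morphism is shifted by the letter
  that the generator fixes (\<open>d\<close>) or by the one it expands (\<open>\<not> d\<close>, to \<open>[\<not> d, d]\<close>).\<close>

lemma left_shiftable_G'_D':
  assumes chi: "\<eta> \<in> special_sturmian_monoid" "left_shiftable \<eta>"
  assumes h: "\<And>x. d # h x = g x @ [d]" "h [d] = [d]" "h [\<not> d] = [\<not> d, d]"
    "h \<in> special_sturmian_monoid" "g \<in> special_sturmian_monoid"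
  shows "left_shiftable (h \<circ> \<eta>)"
  unfolding left_shiftable_def
proof (intro allI impI)
  fix c assume c: "\<forall>a. hd ((h \<circ> \<eta>) [a]) = c"
  note hh = hom_special[OF h(4)] and hchi = hom_special[OF chi(1)]
  have hd_h: "hd (h x) = hd x" if ne: "x \<noteq> []" for x
  proof -
    obtain a y where x: "x = a # y" using ne by (cases x) auto
    have "hd (h [a]) = a" by (cases "a = d") (use h(2,3) in auto)
    then show ?thesis using x hom_Cons[OF hh, of a y] hom_letter[OF hh, of a] by simp
  qed
  have "hd (\<eta> [a]) = c" for a
    using c hd_h[OF hom_letter[OF hchi, of a]] by simp
  then obtain \<psi> where psi: "\<psi> \<in> special_sturmian_monoid" "\<And>a. c # \<psi> [a] = \<eta> [a] @ [c]"
    using chi(2) unfolding left_shiftable_def by blast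
  have eq: "h [c] @ h (\<psi> [a]) = h (\<eta> [a]) @ h [c]" for a
    using arg_cong[OF psi(2)[of a], of h] hom_Cons[OF hh, of c "\<psi> [a]"] hom_append[OF hh] by simp
  show "\<exists>\<psi>\<in>special_sturmian_monoid. \<forall>a. c # \<psi> [a] = (h \<circ> \<eta>) [a] @ [c]"
  proof (cases "c = d")
    case True
    then have "\<forall>a. c # (h \<circ> \<psi>) [a] = (h \<circ> \<eta>) [a] @ [c]" using eq h(2) by simp
    then show ?thesis using special_sturmian_monoid.comp[OF h(4) psi(1)] by blast
  next
    case False
    then have cd: "c = (\<not> d)" by auto
    \<comment> \<open>Now \<open>h [c] = [c, d]\<close>. The surplus \<open>d\<close> in front of
      \<open>h (\<psi> [a])\<close> changes \<open>h\<close> into \<open>g\<close> and reappears at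
      the right end, where it cancels.\<close>
    have "c # (g \<circ> \<psi>) [a] = (h \<circ> \<eta>) [a] @ [c]" for a
    proof -
      have "(c # (g \<circ> \<psi>) [a]) @ [d] = c # d # h (\<psi> [a])" using h(1) by simp
      also have "\<dots> = ((h \<circ> \<eta>) [a] @ [c]) @ [d]" using eq[of a] cd h(3) by simp
      finally show ?thesis by simp
    qed
    then show ?thesis using special_sturmian_monoid.comp[OF h(5) psi(1)] by blast
  qed
qed

text \<open>The arbitrary inner morphism \<open>\<eta>\<close> makes the induction go through: a
  composite is reassociated and its two factors are added one after the other.\<close>

lemma left_shiftable_comp:
  assumes "\<phi> \<in> special_sturmian_monoid"
  shows "\<eta> \<in> special_sturmian_monoid \<Longrightarrow> left_shiftable \<eta> \<Longrightarrow> left_shiftable (\<phi> \<circ> \<eta>)"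
  using assms
proof (induction arbitrary: \<eta> rule: special_sturmian_monoid.induct)
  case G
  have "hd (morph_G x) = False" if "x \<noteq> []" for x
    using that by (cases x) (auto simp: morph_G_def morphism_def)
  then show ?case
    by (intro left_shiftable_G_D[OF G(1) generators_words(1)] special_sturmian_monoid.G')
next
  case D
  have "hd (morph_D x) = True" if "x \<noteq> []" for x
    using that by (cases x) (auto simp: morph_D_def morphism_def)
  then show ?case
    by (intro left_shiftable_G_D[OF D(1) generators_words(2)] special_sturmian_monoid.D')
next
  case G'
  show ?case
    by (rule left_shiftable_G'_D'[OF G' generators_words(1)])
      (simp_all add: special_sturmian_monoid.G special_sturmian_monoid.G',
        simp_all add: morph_G'_def morphism_def)
next
  case D'
  show ?case
    by (rule left_shiftable_G'_D'[OF D' generators_words(2)])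
      (simp_all add: special_sturmian_monoid.D special_sturmian_monoid.D',
        simp_all add: morph_D'_def morphism_def)
next
  case (comp \<phi> \<psi>)
  then have "left_shiftable (\<phi> \<circ> (\<psi> \<circ> \<eta>))"
    by (intro comp.IH special_sturmian_monoid.comp)
  then show ?case by (simp only: comp_assoc)
qed (simp add: comp_def)

lemma left_shiftable_special:
  assumes "\<phi> \<in> special_sturmian_monoid"
  shows "left_shiftable \<phi>"
proof -
  have "\<not> (\<forall>a. hd (id [a]) = c)" for c :: bool
    by (auto intro: exI[of _ "\<not> c"])
  then have "left_shiftable id" unfolding left_shiftable_def by blast
  from left_shiftable_comp[OF assms special_sturmian_monoid.id this] show ?thesis by simp
qed

text \<open>Induction on \<open>v\<close>: the conjugation equation forces all images under
  \<open>\<phi>\<close> to begin with the first letter of \<open>v\<close>, so this letter can be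
  shifted off inside the monoid.\<close>

lemma intermediate_conjugate:
  assumes "\<phi> \<in> special_sturmian_monoid" "\<And>a. (v @ w) @ \<theta> [a] = \<phi> [a] @ (v @ w)"
  shows "\<exists>\<psi> \<in> special_sturmian_monoid.
    (\<forall>a. w @ \<theta> [a] = \<psi> [a] @ w) \<and> (\<forall>a. v @ \<psi> [a] = \<phi> [a] @ v)"
  using assms
proof (induction v arbitrary: \<phi>)
  case Nil
  then show ?case by (intro bexI[of _ \<phi>]) auto
next
  case (Cons c v)
  have "hd (\<phi> [a]) = c" for a
    using Cons.prems(2)[of a] hom_letter[OF hom_special[OF Cons.prems(1)], of a]
    by (cases "\<phi> [a]") auto
  then obtain \<eta> where chi: "\<eta> \<in> special_sturmian_monoid" "\<And>a. c # \<eta> [a] = \<phi> [a] @ [c]"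
    using left_shiftable_special[OF Cons.prems(1)] unfolding left_shiftable_def by blast
  have "c # ((v @ w) @ \<theta> [a]) = c # (\<eta> [a] @ (v @ w))" for a
    using Cons.prems(2)[of a] chi(2)[of a] by simp
  then have "(v @ w) @ \<theta> [a] = \<eta> [a] @ (v @ w)" for a by simp
  from Cons.IH[OF chi(1) this] obtain \<psi> where psi: "\<psi> \<in> special_sturmian_monoid"
    "\<And>a. w @ \<theta> [a] = \<psi> [a] @ w" "\<And>a. v @ \<psi> [a] = \<eta> [a] @ v" by blast
  have "(c # v) @ \<psi> [a] = \<phi> [a] @ (c # v)" for a
    using psi(3)[of a] chi(2)[of a] by simp
  then show ?case using psi by blast
qed


section \<open>Codings of exchanges of two intervals\<close>

text \<open>The lower sequence of slope \<open>\<alpha>\<close> and intercept \<open>\<delta> \<in> [0, 1)\<close> is the coding of the point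
  \<open>\<delta> - (1 - \<alpha>)\<close>. For \<open>b\<close> false the intervals are open on the left and closed on the right, which
  gives the upper sequences.\<close>

definition pos :: "bool \<Rightarrow> real \<Rightarrow> bool" where
  "pos b z \<longleftrightarrow> (if b then 0 \<le> z else 0 < z)"

definition rot :: "bool \<Rightarrow> real \<Rightarrow> real \<Rightarrow> real \<Rightarrow> real" where
  "rot b \<alpha> \<beta> z = (if pos b z then z - \<beta> else z + \<alpha>)"

definition code :: "bool \<Rightarrow> real \<Rightarrow> real \<Rightarrow> real \<Rightarrow> bool stream" where
  "code b \<alpha> \<beta> z = smap (pos b) (siterate (rot b \<alpha> \<beta>) z)"

text \<open>The half-open interval of length \<alpha> + \<beta> that is exchanged; through
  \<open>pos\<close> the flag \<open>b\<close> decides which endpoint belongs to it.\<close>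

definition in_dom :: "bool \<Rightarrow> real \<Rightarrow> real \<Rightarrow> real \<Rightarrow> bool" where
  "in_dom b \<alpha> \<beta> z \<longleftrightarrow> pos b (z + \<beta>) \<and> \<not> pos b (z - \<alpha>)"

lemma pos_mono: "pos b x \<Longrightarrow> x \<le> y \<Longrightarrow> pos b y"
  by (cases b) (auto simp: pos_def)

lemma pos_pos: "0 < x \<Longrightarrow> pos b x"
  by (cases b) (auto simp: pos_def)

lemma pos_ge_0: "pos b x \<Longrightarrow> 0 \<le> x"
  by (cases b) (auto simp: pos_def)

lemma neg_le_0: "\<not> pos b x \<Longrightarrow> x \<le> 0"
  by (cases b) (auto simp: pos_def)

lemma pos_minus: "pos (\<not> b) (- z) \<longleftrightarrow> \<not> pos b z"
  by (cases b) (auto simp: pos_def)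

lemma pos_half: "pos b (z / 2) \<longleftrightarrow> pos b z"
  by (cases b) (auto simp: pos_def)

lemma pos_scale: "0 < c \<Longrightarrow> pos b (c * z) \<longleftrightarrow> pos b z"
  by (cases b) (auto simp: pos_def zero_le_mult_iff zero_less_mult_iff)

lemma in_dom_rot: "0 < \<alpha> \<Longrightarrow> 0 < \<beta> \<Longrightarrow> in_dom b \<alpha> \<beta> z \<Longrightarrow> in_dom b \<alpha> \<beta> (rot b \<alpha> \<beta> z)"
  by (cases b) (auto simp: in_dom_def rot_def pos_def)

lemma in_dom_rot_funpow:
  "0 < \<alpha> \<Longrightarrow> 0 < \<beta> \<Longrightarrow> in_dom b \<alpha> \<beta> z \<Longrightarrow> in_dom b \<alpha> \<beta> ((rot b \<alpha> \<beta> ^^ n) z)"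
  by (induction n) (auto simp: in_dom_rot)

lemma in_dom_bounds: "in_dom b \<alpha> \<beta> z \<Longrightarrow> - \<beta> \<le> z \<and> z \<le> \<alpha>"
  by (cases b) (auto simp: in_dom_def pos_def)

lemma in_dom_diff: "in_dom b \<alpha> \<beta> x \<Longrightarrow> in_dom b \<alpha> \<beta> y \<Longrightarrow> \<bar>x - y\<bar> < \<alpha> + \<beta>"
  by (cases b) (auto simp: in_dom_def pos_def)

lemma in_dom_half: "0 < \<alpha> \<Longrightarrow> 0 < \<beta> \<Longrightarrow> in_dom b \<alpha> \<beta> z \<Longrightarrow> in_dom b \<alpha> \<beta> (z / 2)"
  by (cases b) (auto simp: in_dom_def pos_def)

lemma in_dom_mono:
  "in_dom b \<alpha> \<beta> z \<Longrightarrow> \<alpha> \<le> \<alpha>' \<Longrightarrow> \<beta> \<le> \<beta>' \<Longrightarrow> in_dom b \<alpha>' \<beta>' z"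
  by (cases b) (auto simp: in_dom_def pos_def)

lemma in_dom_scale: "0 < c \<Longrightarrow> in_dom b (c * \<alpha>) (c * \<beta>) (c * z) \<longleftrightarrow> in_dom b \<alpha> \<beta> z"
  using pos_scale[of c b "z + \<beta>"] pos_scale[of c b "z - \<alpha>"]
  by (simp add: in_dom_def distrib_left right_diff_distrib)

lemma code_unfold: "code b \<alpha> \<beta> z = pos b z ## code b \<alpha> \<beta> (rot b \<alpha> \<beta> z)"
  unfolding code_def by (subst siterate.ctr) simp

lemma code_pos: "pos b z \<Longrightarrow> code b \<alpha> \<beta> z = True ## code b \<alpha> \<beta> (z - \<beta>)"
  by (subst code_unfold) (simp add: rot_def)

lemma code_neg: "\<not> pos b z \<Longrightarrow> code b \<alpha> \<beta> z = False ## code b \<alpha> \<beta> (z + \<alpha>)"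
  by (subst code_unfold) (simp add: rot_def)

lemma code_snth: "code b \<alpha> \<beta> z !! n = pos b ((rot b \<alpha> \<beta> ^^ n) z)"
  by (simp add: code_def)

lemma sdrop_code: "sdrop n (code b \<alpha> \<beta> z) = code b \<alpha> \<beta> ((rot b \<alpha> \<beta> ^^ n) z)"
  by (simp add: code_def)

text \<open>Each letter 0 records a translation by \<alpha> and each letter 1 one by -\<beta>. This
  is how words are turned back into displacements of points later on.\<close>

lemma rot_funpow:
  "(rot b \<alpha> \<beta> ^^ n) z = z + \<alpha> * real (count_list (stake n (code b \<alpha> \<beta> z)) False)
     - \<beta> * real (count_list (stake n (code b \<alpha> \<beta> z)) True)"
proof (induction n)
  case (Suc n)
  then show ?case
    by (cases "pos b ((rot b \<alpha> \<beta> ^^ n) z)")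
      (simp_all add: stake_Suc code_snth rot_def[of b \<alpha> \<beta> "(rot b \<alpha> \<beta> ^^ n) z"] algebra_simps
        del: stake.simps(2))
qed simp

text \<open>Only ratios matter. Images under morphisms are codings with other total lengths and are
  normalised by this.\<close>

lemma code_scale: "0 < c \<Longrightarrow> code b (c * \<alpha>) (c * \<beta>) (c * z) = code b \<alpha> \<beta> z"
proof (rule stream_eqI)
  fix n assume c: "0 < c"
  have "(rot b (c * \<alpha>) (c * \<beta>) ^^ n) (c * z) = c * (rot b \<alpha> \<beta> ^^ n) z"
    using c by (induction n) (simp_all add: rot_def pos_scale algebra_simps)
  then show "code b (c * \<alpha>) (c * \<beta>) (c * z) !! n = code b \<alpha> \<beta> z !! n"
    using c by (simp add: code_snth pos_scale)
qed

text \<open>Reflection at 0 swaps the two intervals and the two endpoint conventions; it reduces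
  \<beta> < \<alpha> to the opposite case.\<close>

lemma code_exchange: "code (\<not> b) \<beta> \<alpha> (- z) = smap Not (code b \<alpha> \<beta> z)"
proof (rule stream_eqI)
  fix n
  have "(rot (\<not> b) \<beta> \<alpha> ^^ n) (- z) = - (rot b \<alpha> \<beta> ^^ n) z"
    by (induction n) (simp_all add: rot_def pos_minus)
  then show "code (\<not> b) \<beta> \<alpha> (- z) !! n = smap Not (code b \<alpha> \<beta> z) !! n"
    by (simp add: code_snth pos_minus)
qed

lemma in_dom_exchange: "in_dom b \<alpha> \<beta> z \<Longrightarrow> in_dom (\<not> b) \<beta> \<alpha> (- z)"
  by (cases b) (auto simp: in_dom_def pos_def)

section \<open>Sturmian sequences as codings\<close>

text \<open>The fractional part of \<open>x\<close> is shifted by 1 - \<alpha>, which moves the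
  breakpoint of the rotation to 0.\<close>

lemma rot_lower:
  fixes x \<alpha> :: real
  assumes "0 < \<alpha>" "\<alpha> < 1"
  shows "rot True \<alpha> (1 - \<alpha>) (x - \<lfloor>x\<rfloor> - (1 - \<alpha>)) = x + \<alpha> - \<lfloor>x + \<alpha>\<rfloor> - (1 - \<alpha>)"
    and "\<lfloor>x + \<alpha>\<rfloor> - \<lfloor>x\<rfloor> = of_bool (pos True (x - \<lfloor>x\<rfloor> - (1 - \<alpha>)))"
proof -
  show *: "\<lfloor>x + \<alpha>\<rfloor> - \<lfloor>x\<rfloor> = of_bool (pos True (x - \<lfloor>x\<rfloor> - (1 - \<alpha>)))"
    using assms unfolding pos_def by simp linarith
  show "rot True \<alpha> (1 - \<alpha>) (x - \<lfloor>x\<rfloor> - (1 - \<alpha>)) = x + \<alpha> - \<lfloor>x + \<alpha>\<rfloor> - (1 - \<alpha>)"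
  proof (cases "pos True (x - \<lfloor>x\<rfloor> - (1 - \<alpha>))")
    case True
    then have "\<lfloor>x + \<alpha>\<rfloor> = \<lfloor>x\<rfloor> + 1" using * by simp
    then show ?thesis using True unfolding rot_def by simp
  next
    case False
    then have "\<lfloor>x + \<alpha>\<rfloor> = \<lfloor>x\<rfloor>" using * by simp
    then show ?thesis using False unfolding rot_def by simp
  qed
qed

lemma rot_upper:
  fixes x \<alpha> :: real
  assumes "0 < \<alpha>" "\<alpha> < 1"
  shows "rot False \<alpha> (1 - \<alpha>) (x - \<lceil>x\<rceil> + \<alpha>) = x + \<alpha> - \<lceil>x + \<alpha>\<rceil> + \<alpha>"
    and "\<lceil>x + \<alpha>\<rceil> - \<lceil>x\<rceil> = of_bool (pos False (x - \<lceil>x\<rceil> + \<alpha>))"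
proof -
  show *: "\<lceil>x + \<alpha>\<rceil> - \<lceil>x\<rceil> = of_bool (pos False (x - \<lceil>x\<rceil> + \<alpha>))"
    using assms unfolding pos_def by simp linarith
  show "rot False \<alpha> (1 - \<alpha>) (x - \<lceil>x\<rceil> + \<alpha>) = x + \<alpha> - \<lceil>x + \<alpha>\<rceil> + \<alpha>"
  proof (cases "pos False (x - \<lceil>x\<rceil> + \<alpha>)")
    case True
    then have "\<lceil>x + \<alpha>\<rceil> = \<lceil>x\<rceil> + 1" using * by simp
    then show ?thesis using True unfolding rot_def by simp
  next
    case False
    then have "\<lceil>x + \<alpha>\<rceil> = \<lceil>x\<rceil>" using * by simp
    then show ?thesis using False unfolding rot_def by simp
  qed
qed

lemma sturmian_code:
  assumes "sturmian u"
  obtains b \<alpha> z where "0 < \<alpha>" "\<alpha> < 1" "\<alpha> \<notin> \<rat>" "in_dom b \<alpha> (1 - \<alpha>) z" "u = code b \<alpha> (1 - \<alpha>) z"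
proof -
  from assms obtain \<alpha> \<delta> where a: "0 < \<alpha>" "\<alpha> < 1" "\<alpha> \<notin> \<rat>" and
    u: "(\<forall>n. of_bool (u !! n) = lower_sturmian \<alpha> \<delta> n) \<or> (\<forall>n. of_bool (u !! n) = upper_sturmian \<alpha> \<delta> n)"
    unfolding sturmian_def by blast
  define x where "x n = \<alpha> * real n + \<delta>" for n
  have xS: "\<alpha> * (real n + 1) + \<delta> = x n + \<alpha>" "x (Suc n) = x n + \<alpha>" for n
    by (simp_all add: x_def algebra_simps)
  from u show ?thesis
  proof
    assume u: "\<forall>n. of_bool (u !! n) = lower_sturmian \<alpha> \<delta> n"
    define z where "z = x 0 - \<lfloor>x 0\<rfloor> - (1 - \<alpha>)"
    have z: "(rot True \<alpha> (1 - \<alpha>) ^^ n) z = x n - \<lfloor>x n\<rfloor> - (1 - \<alpha>)" for n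
      by (induction n) (simp_all add: z_def rot_lower(1)[OF a(1,2)] xS(2))
    have "u = code True \<alpha> (1 - \<alpha>) z"
    proof (rule stream_eqI)
      fix n
      have "of_bool (u !! n) = (of_bool (code True \<alpha> (1 - \<alpha>) z !! n) :: int)"
        using u rot_lower(2)[OF a(1,2), of "x n"]
        by (simp add: lower_sturmian_def xS code_snth z flip: x_def)
      then show "u !! n = code True \<alpha> (1 - \<alpha>) z !! n" by (simp only: of_bool_eq_iff)
    qed
    moreover have "in_dom True \<alpha> (1 - \<alpha>) z"
      unfolding in_dom_def pos_def z_def by simp linarith
    ultimately show ?thesis using that a by blast
  next
    assume u: "\<forall>n. of_bool (u !! n) = upper_sturmian \<alpha> \<delta> n"
    define z where "z = x 0 - \<lceil>x 0\<rceil> + \<alpha>"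
    have z: "(rot False \<alpha> (1 - \<alpha>) ^^ n) z = x n - \<lceil>x n\<rceil> + \<alpha>" for n
      by (induction n) (simp_all add: z_def rot_upper(1)[OF a(1,2)] xS(2))
    have "u = code False \<alpha> (1 - \<alpha>) z"
    proof (rule stream_eqI)
      fix n
      have "of_bool (u !! n) = (of_bool (code False \<alpha> (1 - \<alpha>) z !! n) :: int)"
        using u rot_upper(2)[OF a(1,2), of "x n"]
        by (simp add: upper_sturmian_def xS code_snth z flip: x_def)
      then show "u !! n = code False \<alpha> (1 - \<alpha>) z !! n" by (simp only: of_bool_eq_iff)
    qed
    moreover have "in_dom False \<alpha> (1 - \<alpha>) z"
      unfolding in_dom_def pos_def z_def by simp linarith
    ultimately show ?thesis using that a by blast
  qed
qed

section \<open>Injectivity of the coding\<close>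

lemma count_stake: "count_list (stake n u) False = n - count_list (stake n u) True"
  "count_list (stake n u) True \<le> n"
proof -
  have "count_list w False + count_list w True = length w" for w
    by (induction w) auto
  from this[of "stake n u"] show "count_list (stake n u) False = n - count_list (stake n u) True"
    "count_list (stake n u) True \<le> n" by simp_all
qed

lemma rot_funpow_normalized:
  assumes "\<alpha> + \<beta> = 1"
  shows "(rot b \<alpha> \<beta> ^^ n) z = z + real n * \<alpha> - real (count_list (stake n (code b \<alpha> \<beta> z)) True)"
proof -
  have "\<beta> = 1 - \<alpha>" using assms by simp
  show ?thesis
    unfolding rot_funpow count_stake(1) \<open>\<beta> = 1 - \<alpha>\<close>
    by (simp add: of_nat_diff count_stake(2) algebra_simps)
qed

text \<open>If the codings agree, both orbits undergo the same displacements and keep the distance z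
  - z'. By density of the multiples of \<alpha> modulo 1, the orbit of \<open>z\<close> is at some
  time positive but closer to 0 than this distance; the other orbit is then negative.\<close>

lemma code_separates:
  assumes "0 < \<alpha>" "0 < \<beta>" "\<alpha> + \<beta> = 1" "\<alpha> \<notin> \<rat>" "in_dom b \<alpha> \<beta> z" "z' < z"
  shows "code b \<alpha> \<beta> z \<noteq> code b \<alpha> \<beta> z'"
proof
  assume eq: "code b \<alpha> \<beta> z = code b \<alpha> \<beta> z'"
  define \<eta> where "\<eta> = min (z - z') \<alpha>"
  have eta: "0 < \<eta>" "\<eta> \<le> z - z'" "\<eta> \<le> \<alpha>" using assms by (auto simp: \<eta>_def)
  obtain h k where hk: "k > 0" "\<bar>of_int k * \<alpha> - of_int h - (\<eta> / 2 - z)\<bar> < \<eta> / 2"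
    using sequence_of_fractional_parts_is_dense[OF \<open>\<alpha> \<notin> \<rat>\<close> half_gt_zero[OF eta(1)], of "\<eta> / 2 - z"]
    by blast
  define y where "y = z + of_int k * \<alpha> - of_int h"
  have y: "0 < y" "y < \<eta>" using hk(2) unfolding y_def by linarith+
  define n where "n = nat k"
  define c where "c = count_list (stake n (code b \<alpha> \<beta> z)) True"
  have n: "real n = of_int k" using hk(1) by (simp add: n_def)
  have rz: "(rot b \<alpha> \<beta> ^^ n) z = z + real n * \<alpha> - real c"
    unfolding c_def by (rule rot_funpow_normalized[OF assms(3)])
  have rz': "(rot b \<alpha> \<beta> ^^ n) z' = z' + real n * \<alpha> - real c"
    unfolding c_def eq by (rule rot_funpow_normalized[OF assms(3)])
  \<comment> \<open>The iterate and \<open>y\<close> differ by an integer. Both lie in an interval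
    of length 1, \<open>y\<close> in its interior, so they are equal.\<close>
  have "- \<beta> \<le> (rot b \<alpha> \<beta> ^^ n) z \<and> (rot b \<alpha> \<beta> ^^ n) z \<le> \<alpha>"
    by (intro in_dom_bounds[of b] in_dom_rot_funpow assms)
  moreover have "(rot b \<alpha> \<beta> ^^ n) z - y = of_int (h - int c)"
    by (simp add: rz y_def n)
  ultimately have "\<bar>real_of_int (h - int c)\<bar> < 1" using y eta(3) assms(2,3) by linarith
  then have "h - int c = 0" by linarith
  then have "(rot b \<alpha> \<beta> ^^ n) z = y"
    using \<open>(rot b \<alpha> \<beta> ^^ n) z - y = of_int (h - int c)\<close> by simp
  then have "pos b ((rot b \<alpha> \<beta> ^^ n) z)" "\<not> pos b ((rot b \<alpha> \<beta> ^^ n) z')"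
    using y eta(2) rz rz' pos_ge_0[of b "(rot b \<alpha> \<beta> ^^ n) z'"] by (auto intro: pos_pos)
  then show False using arg_cong[OF eq, of "\<lambda>s. s !! n"] by (simp add: code_snth)
qed

text \<open>Equal codings have equal counts of ones, so n (\<alpha> - \<alpha>') stays bounded and
  the slopes agree. Then \<open>code_separates\<close> is applied in both directions.\<close>

lemma code_inject:
  assumes "0 < \<alpha>" "0 < \<beta>" "\<alpha> + \<beta> = 1" "\<alpha> \<notin> \<rat>" "in_dom b \<alpha> \<beta> z"
    and "0 < \<alpha>'" "0 < \<beta>'" "\<alpha>' + \<beta>' = 1" "in_dom b \<alpha>' \<beta>' z'"
    and eq: "code b \<alpha> \<beta> z = code b \<alpha>' \<beta>' z'"
  shows "\<alpha> = \<alpha>' \<and> z = z'"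
proof
  show "\<alpha> = \<alpha>'"
  proof (rule ccontr)
    assume "\<alpha> \<noteq> \<alpha>'"
    then have pos: "0 < \<bar>\<alpha> - \<alpha>'\<bar>" by simp
    obtain n :: nat where n: "4 < real n * \<bar>\<alpha> - \<alpha>'\<bar>" using reals_Archimedean3[OF pos] by blast
    have b1: "- \<beta> \<le> (rot b \<alpha> \<beta> ^^ n) z \<and> (rot b \<alpha> \<beta> ^^ n) z \<le> \<alpha>"
      by (intro in_dom_bounds[of b] in_dom_rot_funpow assms)
    have b2: "- \<beta>' \<le> (rot b \<alpha>' \<beta>' ^^ n) z' \<and> (rot b \<alpha>' \<beta>' ^^ n) z' \<le> \<alpha>'"
      by (intro in_dom_bounds[of b] in_dom_rot_funpow assms)
    have b3: "- \<beta> \<le> z \<and> z \<le> \<alpha>" "- \<beta>' \<le> z' \<and> z' \<le> \<alpha>'"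
      by (intro in_dom_bounds[of b] assms)+
    have "real n * (\<alpha> - \<alpha>') = (rot b \<alpha> \<beta> ^^ n) z - (rot b \<alpha>' \<beta>' ^^ n) z' - (z - z')"
      unfolding rot_funpow_normalized[OF assms(3)] rot_funpow_normalized[OF assms(8)] eq
      by (simp add: algebra_simps)
    then have "\<bar>real n * (\<alpha> - \<alpha>')\<bar> \<le> 4" using b1 b2 b3 assms(1-3,6-8) by linarith
    then show False using n by (simp add: abs_mult)
  qed
  then have "\<beta>' = \<beta>" using assms by simp
  have "\<not> z' < z" "\<not> z < z'"
    using code_separates[OF assms(1-5), of z'] code_separates[OF assms(1-4), of b z' z]
      eq assms(9) unfolding \<open>\<beta>' = \<beta>\<close> \<open>\<alpha> = \<alpha>'\<close>[symmetric] by auto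
  then show "z = z'" by simp
qed


section \<open>Action of the special Sturmian monoid on codings\<close>

text \<open>The exchange of lengths \<alpha>, \<beta> is the first return map, on its domain, of the
  exchange of lengths \<alpha>, \<alpha> + \<beta>: a point with letter 1 leaves the smaller domain
  and returns after one extra step with letter 0.\<close>

lemma morph_G'_code:
  assumes "0 < \<alpha>" "0 < \<beta>" "in_dom b \<alpha> \<beta> z"
  shows "morph_stream morph_G' (code b \<alpha> \<beta> z) = code b \<alpha> (\<alpha> + \<beta>) z"
proof (rule shift_coinduct[where R = "\<lambda>x y. \<exists>z. in_dom b \<alpha> \<beta> z \<and>
    x = morph_stream morph_G' (code b \<alpha> \<beta> z) \<and> y = code b \<alpha> (\<alpha> + \<beta>) z"])
  note hom = hom_special[OF special_sturmian_monoid.G']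
  fix x y assume "\<exists>z. in_dom b \<alpha> \<beta> z \<and> x = morph_stream morph_G' (code b \<alpha> \<beta> z) \<and> y = code b \<alpha> (\<alpha> + \<beta>) z"
  then obtain z where z: "in_dom b \<alpha> \<beta> z" "x = morph_stream morph_G' (code b \<alpha> \<beta> z)" "y = code b \<alpha> (\<alpha> + \<beta>) z"
    by blast
  define w where "w = (if pos b z then [True, False] else [False])"
  have "x = w @- morph_stream morph_G' (code b \<alpha> \<beta> (rot b \<alpha> \<beta> z))"
    unfolding z(2) by (subst code_unfold) (auto simp: morph_stream_Stream[OF hom] w_def, simp_all add: morph_G'_def morphism_def)
  moreover have "y = w @- code b \<alpha> (\<alpha> + \<beta>) (rot b \<alpha> \<beta> z)"
  proof (cases "pos b z")
    case True
    have "\<not> pos b (z - (\<alpha> + \<beta>))"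
      using z(1) pos_mono[of b "z - (\<alpha> + \<beta>)" "z - \<alpha>"] assms(2) unfolding in_dom_def by auto
    then show ?thesis using True code_neg[of b "z - (\<alpha> + \<beta>)" \<alpha> "\<alpha> + \<beta>"]
      by (simp add: z(3) code_pos w_def rot_def algebra_simps)
  qed (simp add: z(3) code_neg w_def rot_def)
  moreover have "w \<noteq> []" by (simp add: w_def)
  ultimately show "\<exists>w x' y'. w \<noteq> [] \<and> x = w @- x' \<and> y = w @- y' \<and> (\<exists>z. in_dom b \<alpha> \<beta> z \<and>
      x' = morph_stream morph_G' (code b \<alpha> \<beta> z) \<and> y' = code b \<alpha> (\<alpha> + \<beta>) z)"
    using in_dom_rot[OF assms(1,2) z(1)] by blast
qed (use assms(3) in blast)

lemma morph_D'_code: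
  assumes "0 < \<alpha>" "0 < \<beta>" "in_dom b \<alpha> \<beta> z"
  shows "morph_stream morph_D' (code b \<alpha> \<beta> z) = code b (\<alpha> + \<beta>) \<beta> z"
proof (rule shift_coinduct[where R = "\<lambda>x y. \<exists>z. in_dom b \<alpha> \<beta> z \<and>
    x = morph_stream morph_D' (code b \<alpha> \<beta> z) \<and> y = code b (\<alpha> + \<beta>) \<beta> z"])
  note hom = hom_special[OF special_sturmian_monoid.D']
  fix x y assume "\<exists>z. in_dom b \<alpha> \<beta> z \<and> x = morph_stream morph_D' (code b \<alpha> \<beta> z) \<and> y = code b (\<alpha> + \<beta>) \<beta> z"
  then obtain z where z: "in_dom b \<alpha> \<beta> z" "x = morph_stream morph_D' (code b \<alpha> \<beta> z)" "y = code b (\<alpha> + \<beta>) \<beta> z"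
    by blast
  define w where "w = (if pos b z then [True] else [False, True])"
  have "x = w @- morph_stream morph_D' (code b \<alpha> \<beta> (rot b \<alpha> \<beta> z))"
    unfolding z(2) by (subst code_unfold) (auto simp: morph_stream_Stream[OF hom] w_def, simp_all add: morph_D'_def morphism_def)
  moreover have "y = w @- code b (\<alpha> + \<beta>) \<beta> (rot b \<alpha> \<beta> z)"
  proof (cases "pos b z")
    case False
    have "pos b (z + (\<alpha> + \<beta>))"
      using z(1) pos_mono[of b "z + \<beta>" "z + (\<alpha> + \<beta>)"] assms(1) unfolding in_dom_def by auto
    then show ?thesis using False code_pos[of b "z + (\<alpha> + \<beta>)" "\<alpha> + \<beta>" \<beta>]
      by (simp add: z(3) code_neg w_def rot_def algebra_simps)
  qed (simp add: z(3) code_pos w_def rot_def)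
  moreover have "w \<noteq> []" by (simp add: w_def)
  ultimately show "\<exists>w x' y'. w \<noteq> [] \<and> x = w @- x' \<and> y = w @- y' \<and> (\<exists>z. in_dom b \<alpha> \<beta> z \<and>
      x' = morph_stream morph_D' (code b \<alpha> \<beta> z) \<and> y' = code b (\<alpha> + \<beta>) \<beta> z)"
    using in_dom_rot[OF assms(1,2) z(1)] by blast
qed (use assms(3) in blast)

lemma generators_conjugation:
  "[False] @ morph_G' [a] = morph_G [a] @ [False]"
  "[True] @ morph_D' [a] = morph_D [a] @ [True]"
  using generators_words[of "[a]"] by simp_all

text \<open>Conjugation by the letter 0 puts a 0 in front of the coding, which means starting one
  step earlier, at z - \<alpha>.\<close>

lemma morph_G_code:
  assumes "0 < \<alpha>" "0 < \<beta>" "in_dom b \<alpha> \<beta> z"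
  shows "morph_stream morph_G (code b \<alpha> \<beta> z) = code b \<alpha> (\<alpha> + \<beta>) (z - \<alpha>)"
proof -
  note s = special_sturmian_monoid.intros
  have "morph_stream morph_G (code b \<alpha> \<beta> z) = False ## code b \<alpha> (\<alpha> + \<beta>) z"
    using conjugation_stream[OF hom_special[OF s(2)] hom_special[OF s(3)] generators_conjugation(1)]
      morph_G'_code[OF assms] by (metis shift.simps)
  then show ?thesis using assms code_neg[of b "z - \<alpha>"] by (simp add: in_dom_def)
qed

lemma morph_D_code:
  assumes "0 < \<alpha>" "0 < \<beta>" "in_dom b \<alpha> \<beta> z"
  shows "morph_stream morph_D (code b \<alpha> \<beta> z) = code b (\<alpha> + \<beta>) \<beta> (z + \<beta>)"
proof -
  note s = special_sturmian_monoid.intros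
  have "morph_stream morph_D (code b \<alpha> \<beta> z) = True ## code b (\<alpha> + \<beta>) \<beta> z"
    using conjugation_stream[OF hom_special[OF s(4)] hom_special[OF s(5)] generators_conjugation(2)]
      morph_D'_code[OF assms] by (metis shift.simps)
  then show ?thesis using assms code_pos[of b "z + \<beta>"] by (simp add: in_dom_def)
qed

text \<open>The point is that the image is a coding at all; its parameters are later recovered from
  the sequence by injectivity.\<close>

lemma special_code:
  assumes "\<phi> \<in> special_sturmian_monoid" "0 < \<alpha>" "0 < \<beta>" "in_dom b \<alpha> \<beta> z"
  shows "\<exists>\<alpha>' \<beta>' z'. 0 < \<alpha>' \<and> 0 < \<beta>' \<and> in_dom b \<alpha>' \<beta>' z' \<and>
    morph_stream \<phi> (code b \<alpha> \<beta> z) = code b \<alpha>' \<beta>' z'"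
  using assms
proof (induction arbitrary: \<alpha> \<beta> z rule: special_sturmian_monoid.induct)
  case id
  then show ?case by (auto simp: morph_stream_id[unfolded id_def])
next
  case G
  have "in_dom b \<alpha> (\<alpha> + \<beta>) (z - \<alpha>)"
    using G by (cases b) (auto simp: in_dom_def pos_def)
  then show ?case using morph_G_code[OF G] G
    by (intro exI[of _ \<alpha>] exI[of _ "\<alpha> + \<beta>"] exI[of _ "z - \<alpha>"]) simp
next
  case G'
  then show ?case using morph_G'_code[OF G'] in_dom_mono[OF G'(3), of \<alpha> "\<alpha> + \<beta>"]
    by (intro exI[of _ \<alpha>] exI[of _ "\<alpha> + \<beta>"] exI[of _ z]) simp
next
  case D
  have "in_dom b (\<alpha> + \<beta>) \<beta> (z + \<beta>)"
    using D by (cases b) (auto simp: in_dom_def pos_def)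
  then show ?case using morph_D_code[OF D] D
    by (intro exI[of _ "\<alpha> + \<beta>"] exI[of _ \<beta>] exI[of _ "z + \<beta>"]) simp
next
  case D'
  then show ?case using morph_D'_code[OF D'] in_dom_mono[OF D'(3), of "\<alpha> + \<beta>" \<beta>]
    by (intro exI[of _ "\<alpha> + \<beta>"] exI[of _ \<beta>] exI[of _ z]) simp
next
  case (comp \<phi> \<psi>)
  from comp.IH(2)[OF comp.prems] obtain \<alpha>' \<beta>' z' where
    1: "0 < \<alpha>'" "0 < \<beta>'" "in_dom b \<alpha>' \<beta>' z'" "morph_stream \<psi> (code b \<alpha> \<beta> z) = code b \<alpha>' \<beta>' z'" by blast
  show ?case
    using comp.IH(1)[OF 1(1-3)]
    unfolding morph_stream_comp[OF hom_special[OF comp.hyps(1)] hom_special[OF comp.hyps(2)]] 1(4) .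
qed

text \<open>The morphism \<open>\<theta>\<close> is the product obtained from \<open>\<phi>\<close> by replacing \<open>G\<close> and \<open>D\<close> by their left
  conjugates.\<close>

lemma special_normal_form:
  assumes "\<phi> \<in> special_sturmian_monoid"
  shows "\<exists>\<theta> \<in> special_sturmian_monoid. \<exists>w. \<exists>(p :: nat) (q :: nat) (r :: nat) (s :: nat).
    p * s = q * r + (1 :: nat) \<and>
    (\<forall>a. w @ \<theta> [a] = \<phi> [a] @ w) \<and>
    (\<forall>b \<alpha> \<beta> z. 0 < \<alpha> \<longrightarrow> 0 < \<beta> \<longrightarrow> in_dom b \<alpha> \<beta> z \<longrightarrow>
       morph_stream \<theta> (code b \<alpha> \<beta> z) = code b (real p * \<alpha> + real q * \<beta>) (real r * \<alpha> + real s * \<beta>) z)"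
  using assms
proof (induction rule: special_sturmian_monoid.induct)
  case id
  show ?case
    by (rule bexI[of _ id], rule exI[of _ "[]"], rule exI[of _ 1], rule exI[of _ 0], rule exI[of _ 0], rule exI[of _ 1])
      (auto simp: morph_stream_id[unfolded id_def] special_sturmian_monoid.id)
next
  case G
  show ?case
    by (rule bexI[of _ morph_G'], rule exI[of _ "[False]"], rule exI[of _ 1], rule exI[of _ 0], rule exI[of _ 1], rule exI[of _ 1])
      (use generators_conjugation(1) morph_G'_code in \<open>auto intro: special_sturmian_monoid.intros\<close>)
next
  case G'
  show ?case
    by (rule bexI[of _ morph_G'], rule exI[of _ "[]"], rule exI[of _ 1], rule exI[of _ 0], rule exI[of _ 1], rule exI[of _ 1])
      (use morph_G'_code in \<open>auto intro: special_sturmian_monoid.intros\<close>)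
next
  case D
  show ?case
    by (rule bexI[of _ morph_D'], rule exI[of _ "[True]"], rule exI[of _ 1], rule exI[of _ 1], rule exI[of _ 0], rule exI[of _ 1])
      (use generators_conjugation(2) morph_D'_code in \<open>auto intro: special_sturmian_monoid.intros\<close>)
next
  case D'
  show ?case
    by (rule bexI[of _ morph_D'], rule exI[of _ "[]"], rule exI[of _ 1], rule exI[of _ 1], rule exI[of _ 0], rule exI[of _ 1])
      (use morph_D'_code in \<open>auto intro: special_sturmian_monoid.intros\<close>)
next
  case (comp \<phi> \<psi>)
  from comp.IH(1) obtain \<theta> w and p q r s :: nat where
    1: "\<theta> \<in> special_sturmian_monoid" "p * s = q * r + (1 :: nat)" "\<And>a. w @ \<theta> [a] = \<phi> [a] @ w"
    "\<And>b \<alpha> \<beta> z. 0 < \<alpha> \<Longrightarrow> 0 < \<beta> \<Longrightarrow> in_dom b \<alpha> \<beta> z \<Longrightarrow>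
       morph_stream \<theta> (code b \<alpha> \<beta> z) = code b (real p * \<alpha> + real q * \<beta>) (real r * \<alpha> + real s * \<beta>) z" by blast
  from comp.IH(2) obtain \<theta>' w' and p' q' r' s' :: nat where
    2: "\<theta>' \<in> special_sturmian_monoid" "p' * s' = q' * r' + (1 :: nat)" "\<And>a. w' @ \<theta>' [a] = \<psi> [a] @ w'"
    "\<And>b \<alpha> \<beta> z. 0 < \<alpha> \<Longrightarrow> 0 < \<beta> \<Longrightarrow> in_dom b \<alpha> \<beta> z \<Longrightarrow>
       morph_stream \<theta>' (code b \<alpha> \<beta> z) = code b (real p' * \<alpha> + real q' * \<beta>) (real r' * \<alpha> + real s' * \<beta>) z" by blast
  note hom = hom_special[OF comp.hyps(1)] hom_special[OF 1(1)] hom_special[OF 2(1)]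
  have conj: "(\<phi> w' @ w) @ (\<theta> \<circ> \<theta>') [a] = (\<phi> \<circ> \<psi>) [a] @ (\<phi> w' @ w)" for a
  proof -
    have "(\<phi> w' @ w) @ (\<theta> \<circ> \<theta>') [a] = \<phi> w' @ \<phi> (\<theta>' [a]) @ w"
      using conjugation_words[OF hom(1,2) 1(3)] by simp
    also have "\<dots> = \<phi> (w' @ \<theta>' [a]) @ w" using hom_append[OF hom(1)] by simp
    also have "\<dots> = (\<phi> \<circ> \<psi>) [a] @ (\<phi> w' @ w)" using hom_append[OF hom(1)] 2(3) by simp
    finally show ?thesis .
  qed
  have act: "morph_stream (\<theta> \<circ> \<theta>') (code b \<alpha> \<beta> z) =
      code b ((p * p' + q * r') * \<alpha> + (p * q' + q * s') * \<beta>) ((r * p' + s * r') * \<alpha> + (r * q' + s * s') * \<beta>) z"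
    if ab: "0 < \<alpha>" "0 < \<beta>" "in_dom b \<alpha> \<beta> z" for b z and \<alpha> \<beta> :: real
  proof -
    \<comment> \<open>The determinant condition makes the diagonal entries positive, so the new
      domain contains the old one and the action of \<open>\<theta>\<close> is known at the same
      \<open>z\<close>.\<close>
    have "p' * s' \<noteq> 0" using 2(2) by simp
    then have "p' \<noteq> 0" "s' \<noteq> 0" by simp_all
    then have ge: "\<alpha> \<le> p' * \<alpha> + q' * \<beta>" "\<beta> \<le> r' * \<alpha> + s' * \<beta>"
      using ab mult_right_mono[of 1 "real p'" \<alpha>] mult_right_mono[of 1 "real s'" \<beta>]
      by (auto intro: add_increasing add_increasing2)
    have dom: "in_dom b (p' * \<alpha> + q' * \<beta>) (r' * \<alpha> + s' * \<beta>) z"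
      using in_dom_mono[OF ab(3) ge] .
    have "0 < p' * \<alpha> + q' * \<beta>" "0 < r' * \<alpha> + s' * \<beta>" using ge ab by linarith+
    then show ?thesis
      unfolding morph_stream_comp[OF hom(2,3)] 2(4)[OF ab]
      by (subst 1(4)[OF _ _ dom]) (simp_all add: algebra_simps)
  qed
  have "int p * int s = int q * int r + 1" "int p' * int s' = int q' * int r' + 1"
    using arg_cong[OF 1(2), of int] arg_cong[OF 2(2), of int] by simp_all
  then have "(int p * int p' + int q * int r') * (int r * int q' + int s * int s') =
      (int p * int q' + int q * int s') * (int r * int p' + int s * int r') + 1"
    by algebra
  then have det: "(p * p' + q * r') * (r * q' + s * s') = (p * q' + q * s') * (r * p' + s * r') + (1 :: nat)"
    by (metis (mono_tags, lifting) of_nat_1 of_nat_add of_nat_eq_iff of_nat_mult)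
  define P Q R S where PQRS: "P = p * p' + q * r'" "Q = p * q' + q * s'" "R = r * p' + s * r'" "S = r * q' + s * s'"
  have act': "\<forall>b \<alpha> \<beta> z. 0 < \<alpha> \<longrightarrow> 0 < \<beta> \<longrightarrow> in_dom b \<alpha> \<beta> z \<longrightarrow>
      morph_stream (\<theta> \<circ> \<theta>') (code b \<alpha> \<beta> z) = code b (real P * \<alpha> + real Q * \<beta>) (real R * \<alpha> + real S * \<beta>) z"
    using act unfolding PQRS by simp
  have "P * S = Q * R + 1" unfolding PQRS using det .
  then show ?case using conj act' special_sturmian_monoid.comp[OF 1(1) 2(1)] by blast
qed


section \<open>Square roots of codings\<close>

lemma square_prefix_period:
  assumes "square_prefix x u"
  shows "0 < length x" "i < length x \<Longrightarrow> u !! (i + length x) = u !! i"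
proof -
  have x: "x \<noteq> []" "stake (length (x @ x)) u = x @ x"
    using assms unfolding square_prefix_def by blast+
  show "0 < length x" using x(1) by simp
  show "u !! (i + length x) = u !! i" if i: "i < length x"
  proof -
    have "u !! j = (x @ x) ! j" if "j < length (x @ x)" for j
      using stake_nth[OF that, of u] x(2) by simp
    from this[of i] this[of "i + length x"] show ?thesis using i by (simp add: nth_append)
  qed
qed

text \<open>A square prefix with root length n repeats the first n letters at distance n, so a
  single mismatch excludes it.\<close>

lemma shortest_square_prefixI:
  assumes "x \<noteq> []" "u = x @- x @- s"
    and "\<And>n. 0 < n \<Longrightarrow> n < length x \<Longrightarrow> \<exists>i<n. u !! (i + n) \<noteq> u !! i"
  shows "shortest_square_prefix x u"
  unfolding shortest_square_prefix_def
proof (intro conjI allI impI)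
  show "square_prefix x u" using assms(1) by (simp add: square_prefix_def assms(2) stake_shift)
  fix y assume "square_prefix y u"
  from square_prefix_period[OF this] assms(3)[of "length y"] show "length x \<le> length y"
    by (meson not_less)
qed

lemma square_prefix_shift:
  assumes "square_prefix x u"
  shows "u = x @- x @- sdrop (2 * length x) u"
proof -
  have "u = (x @ x) @- sdrop (length (x @ x)) u"
    using assms stake_sdrop[of "length (x @ x)" u] unfolding square_prefix_def by simp
  then show ?thesis by (simp add: mult_2)
qed

lemma square_prefix_exchange:
  "square_prefix (map Not x) (smap Not u) \<longleftrightarrow> square_prefix x u"
proof -
  have "inj (map Not)" by (auto intro: injI simp: inj_map_eq_map inj_def)
  from inj_eq[OF this, of "stake (length (x @ x)) u" "x @ x"] show ?thesis
    by (simp add: square_prefix_def)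
qed

lemma map_Not_Not: "map Not (map Not x) = x"
  by (induction x) simp_all

lemma smap_Not_Not: "smap Not (smap Not u) = u"
  by (rule stream_eqI) simp

lemma shortest_square_prefix_exchange:
  assumes "shortest_square_prefix x u"
  shows "shortest_square_prefix (map Not x) (smap Not u)"
  unfolding shortest_square_prefix_def
proof (intro conjI allI impI)
  show "square_prefix (map Not x) (smap Not u)"
    using assms by (simp add: square_prefix_exchange shortest_square_prefix_def)
  fix y assume "square_prefix y (smap Not u)"
  then have "square_prefix (map Not y) u"
    using square_prefix_exchange[of "map Not y" u] by (simp add: map_Not_Not del: map_map)
  then show "length (map Not x) \<le> length y"
    using assms unfolding shortest_square_prefix_def by fastforce
qed

section \<open>Runs and blocks in codings\<close>

lemma replicate_shift_Stream: "replicate n a @- a ## s = a ## replicate n a @- s"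
  by (induction n) simp_all

lemma code_zeros:
  assumes "\<And>i. i < j \<Longrightarrow> \<not> pos b (x + real i * \<alpha>)"
  shows "code b \<alpha> \<beta> x = replicate j False @- code b \<alpha> \<beta> (x + real j * \<alpha>)"
  using assms
proof (induction j arbitrary: x)
  case (Suc j)
  have "\<not> pos b (x + \<alpha> + real i * \<alpha>)" if "i < j" for i
    using Suc.prems[of "Suc i"] that by (simp add: algebra_simps)
  from Suc.IH[OF this] show ?case
    using Suc.prems[of 0] code_neg[of b x \<alpha> \<beta>] by (simp add: algebra_simps)
qed simp

text \<open>This also covers the last block, because \<open>v\<close> starts with 1. It serves to
  rule out short square prefixes of sequences that start with A.\<close>

lemma blocks_next_True:
  assumes "(concat (replicate l (True # replicate k False)) @- v) !! m"
    and "m < l * Suc k" "v !! 0"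
  shows "(concat (replicate l (True # replicate k False)) @- v) !! (m + Suc k)"
  using assms
proof (induction l arbitrary: m)
  case (Suc l)
  let ?B = "True # replicate k False"
  let ?u = "concat (replicate l ?B) @- v"
  have u: "concat (replicate (Suc l) ?B) @- v = ?B @- ?u" by simp
  have shift: "(?B @- ?u) !! (n + Suc k) = ?u !! n" for n
    using shift_snth_ge[of ?B "n + Suc k" ?u] by simp
  consider "m = 0" | "0 < m" "m < Suc k" | "Suc k \<le> m" by linarith
  then show ?case
  proof cases
    case 1
    have "?u !! 0" using Suc.prems(3) by (cases l) simp_all
    then show ?thesis unfolding u 1 using shift[of 0] by simp
  next
    case 2
    then have "(?B @- ?u) !! m = ?B ! m" by (intro shift_snth_less) simp
    also have "\<dots> = False" using 2 by (simp add: nth_Cons')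
    finally show ?thesis using Suc.prems(1) unfolding u by simp
  next
    case 3
    then obtain n where n: "m = n + Suc k" by (metis add.commute le_Suc_ex)
    have "?u !! n" using Suc.prems(1) unfolding u n shift .
    then have "?u !! (n + Suc k)" using Suc.IH[of n] Suc.prems(2,3) n by simp
    then show ?thesis unfolding u n shift .
  qed
qed simp

text \<open>Let \<open>\<alpha> < \<beta>\<close> and \<open>\<beta> = k \<alpha> + r\<close>. The codings then consist of the blocks \<open>B = 1 0\<^sup>k\<close> and
  \<open>A = 1 0\<^sup>k\<^sup>+\<^sup>1\<close>, and the shortest square prefix has root \<open>0\<close>, \<open>0 1 0\<^sup>k\<^sup>-\<^sup>1\<close>, \<open>0 1 0\<^sup>k\<close>, \<open>B\<close> or
  \<open>A B\<^sup>l\<close> with \<open>l\<close> the number of blocks \<open>B\<close> after the first block. The root is also a prefix of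
  the coding of \<open>z / 2\<close>, because its cylinder has \<open>0\<close> in its closure.\<close>

context
  fixes b :: bool and \<alpha> \<beta> r :: real and k :: nat
  assumes alpha: "0 < \<alpha>" and r: "0 < r" "r < \<alpha>" and beta: "\<beta> = real k * \<alpha> + r" and k: "0 < k"
begin

text \<open>Going down by \<beta> and up k times by \<alpha> amounts to a shift by -r; the k points
  in between are at most y - \<alpha> and hence coded by 0.\<close>

lemma code_block:
  assumes "pos b y" "\<not> pos b (y - \<alpha>)"
  shows "code b \<alpha> \<beta> y = (True # replicate k False) @- code b \<alpha> \<beta> (y - r)"
proof -
  have "\<not> pos b (y - \<beta> + real i * \<alpha>)" if "i < k" for i
  proof -
    have "real (Suc i) * \<alpha> \<le> real k * \<alpha>" using that alpha by (intro mult_right_mono) auto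
    then have "y - \<beta> + real i * \<alpha> \<le> y - \<alpha>" using r(1) by (simp add: beta algebra_simps)
    then show ?thesis using assms(2) pos_mono by blast
  qed
  from code_zeros[OF this, of k \<beta>] show ?thesis
    using code_pos[OF assms(1), of \<alpha> \<beta>] by (simp add: beta algebra_simps)
qed

lemma code_blocks:
  assumes "\<And>i. i < l \<Longrightarrow> pos b (y - real i * r)" "\<not> pos b (y - \<alpha>)"
  shows "code b \<alpha> \<beta> y = concat (replicate l (True # replicate k False)) @- code b \<alpha> \<beta> (y - real l * r)"
  using assms
proof (induction l arbitrary: y)
  case (Suc l)
  have "pos b (y - r - real i * r)" if "i < l" for i
    using Suc.prems(1)[of "Suc i"] that by (simp add: algebra_simps)
  moreover have "\<not> pos b (y - r - \<alpha>)"
    using Suc.prems(2) pos_mono[of b "y - r - \<alpha>" "y - \<alpha>"] r(1) by auto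
  ultimately show ?case
    using Suc.IH[of "y - r"] code_block[of y] Suc.prems(1)[of 0] Suc.prems(2)
    by (simp add: algebra_simps)
qed simp

text \<open>If the second letter is 1, the sequence starts with 0 B, and the next letter decides
  between the last two roots that begin with 0. As z \<le> 0, the point z / 2 + \<alpha> is then
  coded by 1 as well, so the coding of z / 2 also starts with 0 B.\<close>

lemma root_starting_0:
  assumes "in_dom b \<alpha> \<beta> z" "\<not> pos b z"
  shows "\<exists>x t. shortest_square_prefix x (code b \<alpha> \<beta> z) \<and> code b \<alpha> \<beta> (z / 2) = x @- t"
proof (cases "pos b (z + \<alpha>)")
  case False
  have "code b \<alpha> \<beta> z = [False] @- [False] @- code b \<alpha> \<beta> (z + \<alpha> + \<alpha>)"
    using code_neg[OF assms(2)] code_neg[OF False] by simp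
  then have "shortest_square_prefix [False] (code b \<alpha> \<beta> z)"
    by (intro shortest_square_prefixI) auto
  moreover have "code b \<alpha> \<beta> (z / 2) = [False] @- code b \<alpha> \<beta> (z / 2 + \<alpha>)"
    using code_neg[of b "z / 2"] assms(2) by (simp add: pos_half)
  ultimately show ?thesis by blast
next
  case True
  obtain k' where k': "k = Suc k'" using k by (cases k) auto
  let ?B = "True # replicate k False"
  define u where "u = code b \<alpha> \<beta> z"
  have z: "\<not> pos b (z + \<alpha> - \<alpha>)" "\<not> pos b (z / 2 + \<alpha> - \<alpha>)" using assms(2) by (simp_all add: pos_half)
  have half: "pos b (z / 2 + \<alpha>)"
    using pos_mono[OF True, of "z / 2 + \<alpha>"] neg_le_0[OF assms(2)] by simp
  have code_half: "code b \<alpha> \<beta> (z / 2) = False ## ?B @- code b \<alpha> \<beta> (z / 2 + \<alpha> - r)"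
    using code_neg[of b "z / 2"] code_block[OF half z(2)] assms(2) by (simp add: pos_half)
  have u: "u = False ## ?B @- code b \<alpha> \<beta> (z + \<alpha> - r)"
    unfolding u_def using code_neg[OF assms(2)] code_block[OF True z(1)] by simp
  have u01: "u !! 0 = False" "u !! 1 = True" unfolding u by simp_all
  have u0: "u !! i = False" if "2 \<le> i" "i \<le> Suc k" for i
  proof -
    obtain j where j: "i = Suc (Suc j)" using \<open>2 \<le> i\<close> by (metis One_nat_def Suc_1 Suc_le_D le_SucE not_less_eq_eq)
    then show ?thesis unfolding u using that by simp
  qed
  \<comment> \<open>For n \<ge> 2 the 1 at position 1 meets a 0 at position n + 1. The second
    alternative, n = k + 1, is for the root 0 B.\<close>
  have short: "\<exists>i<n. u !! (i + n) \<noteq> u !! i" if "0 < n" "Suc n \<le> Suc k \<or> (Suc n = Suc (Suc k) \<and> u !! Suc n = False)" for n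
  proof (cases "n = 1")
    case True
    then show ?thesis using u01 by (intro exI[of _ 0]) simp
  next
    case False
    then have "u !! Suc n = False" using that u0[of "Suc n"] by auto
    then show ?thesis using u01 False that(1) by (intro exI[of _ 1]) simp
  qed
  show ?thesis
  proof (cases "pos b (z + \<alpha> - r)")
    case True
    have "\<not> pos b (z + \<alpha> - r - \<alpha>)"
      using z(1) pos_mono[of b "z + \<alpha> - r - \<alpha>" "z + \<alpha> - \<alpha>"] r by auto
    note code_block[OF True this]
    then have "u = (False # True # replicate k' False) @- (False # True # replicate k' False) @-
        False ## code b \<alpha> \<beta> (z + \<alpha> - r - r)"
      unfolding u by (simp add: k' replicate_shift_Stream)
    moreover have "\<exists>i<n. u !! (i + n) \<noteq> u !! i" if "0 < n" "n < length (False # True # replicate k' False)" for n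
      using short[of n] that by (simp add: k')
    ultimately have "shortest_square_prefix (False # True # replicate k' False) u"
      by (intro shortest_square_prefixI) auto
    moreover have "code b \<alpha> \<beta> (z / 2) = (False # True # replicate k' False) @- False ## code b \<alpha> \<beta> (z / 2 + \<alpha> - r)"
      unfolding code_half by (simp add: k' replicate_shift_Stream)
    ultimately show ?thesis unfolding u_def by blast
  next
    case False
    have "pos b (z + \<alpha> - r + \<alpha>)" using pos_mono[OF True, of "z + \<alpha> - r + \<alpha>"] r by simp
    moreover have "\<not> pos b (z + \<alpha> - r + \<alpha> - \<alpha>)"
      using False by (simp only: add_diff_cancel_right' not_False_eq_True)
    ultimately have "code b \<alpha> \<beta> (z + \<alpha> - r) = False ## ?B @- code b \<alpha> \<beta> (z + \<alpha> - r + \<alpha> - r)"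
      using code_neg[OF False] code_block by simp
    then have u2: "u = (False # ?B) @- (False # ?B) @- code b \<alpha> \<beta> (z + \<alpha> - r + \<alpha> - r)"
      unfolding u by simp
    have "u !! Suc (Suc k) = False"
      unfolding u2 by (simp add: shift_snth)
    then have "\<exists>i<n. u !! (i + n) \<noteq> u !! i" if "0 < n" "n < length (False # ?B)" for n
      using short[of n] that by (auto simp: less_Suc_eq)
    then have "shortest_square_prefix (False # ?B) u"
      by (intro shortest_square_prefixI[OF _ u2]) auto
    then show ?thesis using code_half unfolding u_def by (metis shift.simps(2))
  qed
qed

text \<open>If B is followed by 1, the root is B. Otherwise the first block is A, then come l blocks
  B and another A, and at least l blocks B follow again.\<close>

lemma root_starting_1:
  assumes "in_dom b \<alpha> \<beta> z" "pos b z"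
  shows "\<exists>x t. shortest_square_prefix x (code b \<alpha> \<beta> z) \<and> code b \<alpha> \<beta> (z / 2) = x @- t"
proof -
  let ?B = "True # replicate k False"
  define u where "u = code b \<alpha> \<beta> z"
  have z: "\<not> pos b (z - \<alpha>)" using assms(1) by (simp add: in_dom_def)
  have z0: "0 \<le> z" using pos_ge_0[OF assms(2)] .
  have half: "pos b (z / 2)" "\<not> pos b (z / 2 - \<alpha>)"
    using assms(2) pos_half[of b z] z pos_mono[of b "z / 2 - \<alpha>" "z - \<alpha>"] z0 by auto
  have u: "u = ?B @- code b \<alpha> \<beta> (z - r)" unfolding u_def by (rule code_block[OF assms(2) z])
  have u0: "u !! 0 = True" unfolding u by simp
  have uk: "u !! i = False" if "0 < i" "i \<le> k" for i
  proof -
    have "u !! i = ?B ! i" unfolding u using that by (intro shift_snth_less) simp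
    then show ?thesis using that by (simp add: nth_Cons')
  qed
  show ?thesis
  proof (cases "pos b (z - r)")
    case True
    have "\<not> pos b (z - r - \<alpha>)" using z pos_mono[of b "z - r - \<alpha>" "z - \<alpha>"] r by auto
    then have u2: "u = ?B @- ?B @- code b \<alpha> \<beta> (z - r - r)"
      unfolding u using code_block[OF True] by simp
    have "\<exists>i<n. u !! (i + n) \<noteq> u !! i" if "0 < n" "n < length ?B" for n
      using u0 uk[of n] that by (intro exI[of _ 0]) simp
    then have "shortest_square_prefix ?B u" by (intro shortest_square_prefixI[OF _ u2]) auto
    then show ?thesis using code_block[OF half] unfolding u_def by blast
  next
    case False
    let ?A = "?B @ [False]"
    define z1 where "z1 = z - r + \<alpha>"
    have z1: "\<not> pos b (z1 - \<alpha>)" using False by (simp add: z1_def)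
    have "\<exists>l. \<not> pos b (z1 - real l * r)"
    proof -
      obtain l :: nat where "z1 < real l * r" using reals_Archimedean3[OF r(1)] by blast
      then show ?thesis using pos_ge_0[of b "z1 - real l * r"] by (intro exI[of _ l]) auto
    qed
    then have ex: "\<exists>l. \<not> pos b (z1 - real (Suc l) * r)"
    proof
      fix l assume l: "\<not> pos b (z1 - real l * r)"
      have "z1 - real (Suc l) * r \<le> z1 - real l * r" using r(1) by (simp add: algebra_simps)
      then show ?thesis using l pos_mono by blast
    qed
    \<comment> \<open>Number the blocks after the first A from 0. Up to the next A, block i starts
      at z1 - i r, and it is a B exactly if z1 - (i + 1) r is coded by 1; so \<open>l\<close> counts
      the blocks B before that A, which starts at \<open>z2\<close> and ends at
      \<open>z3\<close>.\<close>
    define l where "l = (LEAST l. \<not> pos b (z1 - real (Suc l) * r))"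
    have l: "\<not> pos b (z1 - real (Suc l) * r)" unfolding l_def by (rule LeastI_ex[OF ex])
    have l_less: "pos b (z1 - real (Suc i) * r)" if "i < l" for i
      using not_less_Least[of i "\<lambda>l. \<not> pos b (z1 - real (Suc l) * r)"] that unfolding l_def by blast
    have pos_z1: "pos b z1" using pos_mono[OF assms(2), of z1] r by (simp add: z1_def)
    have pos_i: "pos b (z1 - real i * r)" if "i \<le> l" for i
      using l_less[of "i - 1"] that pos_z1 by (cases i) auto
    define z2 where "z2 = z1 - real l * r"
    have z2: "pos b z2" "\<not> pos b (z2 - r)" "\<not> pos b (z2 - \<alpha>)"
    proof -
      show "pos b z2" unfolding z2_def by (rule pos_i) simp
      show "\<not> pos b (z2 - r)" using l unfolding z2_def by (simp add: algebra_simps)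
      then show "\<not> pos b (z2 - \<alpha>)" using pos_mono[of b "z2 - \<alpha>" "z2 - r"] r by auto
    qed
    define z3 where "z3 = z2 - r + \<alpha>"
    have z3: "\<not> pos b (z3 - \<alpha>)" using z2(2) by (simp add: z3_def)
    have rz: "z \<le> r" using neg_le_0[OF False] by simp
    have pos_z2: "0 < z2 + (r - z / 2)"
      using z2(1) False rz r(1) assms(2) by (cases b) (auto simp: pos_def)
    \<comment> \<open>Both summands are nonnegative; which one is strictly positive depends on the
      endpoint convention \<open>b\<close>.\<close>
    have pos_z2': "0 < z2 + (r - z)"
      using z2(1) False by (cases b) (auto simp: pos_def)
    \<comment> \<open>As z1 - z2 = l r, the condition says y > (l - 1) r, which leaves room for
      \<open>l\<close> blocks B.\<close>
    have near: "pos b (y - real i * r)" if i: "i < l" and y: "0 < y - (z1 - z2) + r" for i y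
    proof -
      have "real (Suc i) * r \<le> real l * r" using i r(1) by (intro mult_right_mono) auto
      then have "real i * r + r \<le> real l * r" by (simp add: algebra_simps)
      then have "0 < y - real i * r" using y unfolding z2_def by linarith
      then show ?thesis by (rule pos_pos)
    qed
    let ?X = "?A @ concat (replicate l ?B)"
    define v where "v = code b \<alpha> \<beta> z2"
    have "u = ?B @- False ## code b \<alpha> \<beta> z1"
      unfolding u using code_neg[OF False] by (simp add: z1_def)
    then have uv: "u = ?A @- concat (replicate l ?B) @- v"
      using code_blocks[of l z1] pos_i z1 by (simp add: v_def z2_def)
    have "v = ?B @- False ## code b \<alpha> \<beta> z3"
      unfolding v_def using code_block[OF z2(1,3)] code_neg[OF z2(2)] by (simp add: z3_def)
    moreover have "code b \<alpha> \<beta> z3 = concat (replicate l ?B) @- code b \<alpha> \<beta> (z3 - real l * r)"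
    proof (rule code_blocks[OF _ z3])
      fix i assume "i < l"
      then show "pos b (z3 - real i * r)"
        by (rule near) (use pos_z2' pos_ge_0[OF z2(1)] in \<open>simp add: z3_def z1_def\<close>)
    qed
    ultimately have u2: "u = ?X @- ?X @- code b \<alpha> \<beta> (z3 - real l * r)"
      using uv by simp
    have "\<exists>i<n. u !! (i + n) \<noteq> u !! i" if n: "0 < n" "n < length ?X" for n
    proof (cases "u !! n")
      case False
      then show ?thesis using n u0 by (intro exI[of _ 0]) simp
    next
      case True
      \<comment> \<open>The letter at k + 1 is the last 0 of A, whereas n is the start of a later
        block and the letter at n + k + 1 is 1.\<close>
      have uSk: "u !! Suc k = False" unfolding uv by (simp add: shift_snth nth_append)
      have "Suc k < n"
      proof (rule ccontr)
        assume "\<not> Suc k < n"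
        then show False using uk[of n] uSk True n by (cases "n = Suc k") auto
      qed
      then obtain m where m: "n = m + Suc (Suc k)" by (metis add.commute le_Suc_ex Suc_leI)
      let ?w = "concat (replicate l ?B) @- v"
      have w: "u !! (i + Suc (Suc k)) = ?w !! i" for i
        unfolding uv using shift_snth_ge[of ?A "i + Suc (Suc k)" ?w] by simp
      have "length (concat (replicate l ?B)) = l * Suc k" by (simp add: length_concat sum_list_replicate)
      then have "m < l * Suc k" using n(2) m by simp
      moreover have "v !! 0" unfolding v_def by (simp add: code_pos[OF z2(1)])
      ultimately have "?w !! (m + Suc k)" using blocks_next_True[of l k v m] True w[of m] m by simp
      then have "u !! (Suc k + n)" using w[of "m + Suc k"] m by (simp add: algebra_simps)
      then show ?thesis using uSk \<open>Suc k < n\<close> by blast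
    qed
    then have "shortest_square_prefix ?X u" by (intro shortest_square_prefixI[OF _ u2]) auto
    moreover have "\<exists>t. code b \<alpha> \<beta> (z / 2) = ?X @- t"
    proof -
      have neg: "\<not> pos b (z / 2 - r)" using False pos_mono[of b "z / 2 - r" "z - r"] z0 by auto
      define y where "y = z / 2 - r + \<alpha>"
      have "code b \<alpha> \<beta> (z / 2) = ?A @- code b \<alpha> \<beta> y"
        using code_block[OF half] code_neg[OF neg] by (simp add: y_def)
      moreover have "code b \<alpha> \<beta> y = concat (replicate l ?B) @- code b \<alpha> \<beta> (y - real l * r)"
      proof (rule code_blocks)
        show "\<not> pos b (y - \<alpha>)" using neg by (simp add: y_def)
        fix i assume "i < l"
        then show "pos b (y - real i * r)"
          by (rule near) (use pos_z2 in \<open>simp add: y_def z1_def\<close>)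
      qed
      ultimately show ?thesis by auto
    qed
    ultimately show ?thesis unfolding u_def by blast
  qed
qed

end

lemma sqrt_step_less:
  assumes "0 < \<alpha>" "\<alpha> < \<beta>" "\<And>m :: nat. \<beta> \<noteq> real m * \<alpha>" "in_dom b \<alpha> \<beta> z"
  shows "\<exists>x t. shortest_square_prefix x (code b \<alpha> \<beta> z) \<and> code b \<alpha> \<beta> (z / 2) = x @- t"
proof -
  define k where "k = nat \<lfloor>\<beta> / \<alpha>\<rfloor>"
  define r where "r = \<beta> - real k * \<alpha>"
  have "1 \<le> \<beta> / \<alpha>" using assms(1,2) by simp
  then have k: "0 < k" "real k \<le> \<beta> / \<alpha>" "\<beta> / \<alpha> < real k + 1" unfolding k_def by linarith+
  have "real k * \<alpha> \<le> \<beta>" "\<beta> < (real k + 1) * \<alpha>"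
    using k(2,3) assms(1) by (simp_all add: pos_le_divide_eq pos_divide_less_eq)
  then have r: "0 < r" "r < \<alpha>" "\<beta> = real k * \<alpha> + r"
    using assms(3)[of k] by (simp_all add: r_def algebra_simps)
  show ?thesis
    using root_starting_0[OF assms(1) r k(1) assms(4)] root_starting_1[OF assms(1) r k(1) assms(4)] by blast
qed

text \<open>By irrationality neither length is an integer multiple of the other; for \<beta> <
  \<alpha> the letters are exchanged by reflection.\<close>

lemma sqrt_step:
  assumes "0 < \<alpha>" "0 < \<beta>" "\<alpha> + \<beta> = 1" "\<alpha> \<notin> \<rat>" "in_dom b \<alpha> \<beta> z"
  shows "\<exists>x t. shortest_square_prefix x (code b \<alpha> \<beta> z) \<and> code b \<alpha> \<beta> (z / 2) = x @- t"
proof -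
  have multiple: "\<beta> \<noteq> real m * \<alpha>" if "0 < \<alpha>" "\<alpha> + \<beta> = 1" "\<alpha> \<notin> \<rat>" for m and \<alpha> \<beta> :: real
  proof
    assume "\<beta> = real m * \<alpha>"
    then have "(real m + 1) * \<alpha> = 1" using that(2) by (simp add: algebra_simps)
    then have "\<alpha> = 1 / (real m + 1)" by (simp add: field_simps)
    then show False using that(3) by (metis Rats_1 Rats_add Rats_divide Rats_of_nat)
  qed
  have beta: "\<beta> \<notin> \<rat>"
  proof
    assume "\<beta> \<in> \<rat>"
    then have "1 - \<beta> \<in> \<rat>" by simp
    then show False using assms(3,4) by (metis add_diff_cancel_right')
  qed
  consider "\<alpha> < \<beta>" | "\<beta> < \<alpha>" using multiple[OF assms(1,3,4), of 1] by fastforce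
  then show ?thesis
  proof cases
    case 1
    then show ?thesis using sqrt_step_less assms(1,5) multiple[OF assms(1,3,4)] by blast
  next
    case 2
    have "\<alpha> \<noteq> real m * \<beta>" for m using multiple[OF assms(2) _ beta] assms(3) by simp
    from sqrt_step_less[OF assms(2) 2 this in_dom_exchange[OF assms(5)]] obtain x t where
      x: "shortest_square_prefix x (code (\<not> b) \<beta> \<alpha> (- z))" "code (\<not> b) \<beta> \<alpha> (- (z / 2)) = x @- t"
      by auto
    have "shortest_square_prefix (map Not x) (code b \<alpha> \<beta> z)"
      using shortest_square_prefix_exchange[OF x(1)] unfolding code_exchange smap_Not_Not .
    moreover have "code b \<alpha> \<beta> (z / 2) = map Not x @- smap Not t"
      using arg_cong[OF x(2), of "smap Not"] unfolding code_exchange smap_Not_Not by simp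
    ultimately show ?thesis by blast
  qed
qed

section \<open>Uniqueness of the square factorization and the root of a coding\<close>

lemma shortest_square_prefix_unique:
  assumes "shortest_square_prefix x u" "shortest_square_prefix y u"
  shows "x = y"
proof -
  have x: "square_prefix x u" "square_prefix y u" "length x = length y"
    using assms unfolding shortest_square_prefix_def by (auto intro: antisym)
  then have "x @ x = y @ y" unfolding square_prefix_def by simp
  then show ?thesis using x(3) by simp
qed

lemma square_product_unfold:
  "shd X \<noteq> [] \<Longrightarrow> square_product X = shd X @- shd X @- square_product (stl X)"
  unfolding square_product_def by (subst flat_unfold) simp_all

lemma square_factorization_unique:
  assumes X: "square_factorization u X" and Y: "square_factorization u Y"
  shows "X = Y"
proof -
  note X' = X[unfolded square_factorization_def] and Y' = Y[unfolded square_factorization_def]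
  have root: "X !! n = Y !! n" if "square_product (sdrop n X) = square_product (sdrop n Y)" for n
    using X' Y' that shortest_square_prefix_unique by metis
  have product: "square_product (sdrop n X) = square_product (sdrop n Y)" for n
  proof (induction n)
    case 0
    show ?case using X' Y' by simp
  next
    case (Suc n)
    have "square_product (sdrop n Z) = Z !! n @- Z !! n @- square_product (sdrop (Suc n) Z)"
      if "Z !! n \<noteq> []" for Z
      using square_product_unfold[of "sdrop n Z"] that by (simp del: sdrop.simps add: sdrop_stl[symmetric])
    from this[of X] this[of Y] show ?case using Suc.IH root[OF Suc.IH] X' Y' by simp
  qed
  show ?thesis by (rule stream_eqI) (use root product in blast)
qed

lemma square_root_eqI: "square_factorization u X \<Longrightarrow> square_root u = flat X"
  unfolding square_root_def using square_factorization_unique by (metis the_equality)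

text \<open>Removing the square of \<open>X z\<close> from the coding of \<open>z\<close> leads to
  \<open>N z\<close>, and removing \<open>X z\<close> once from the coding of z / 2 leads to
  \<open>N z / 2\<close>. Iteration gives the factorization and the product of its roots.\<close>

theorem square_root_code:
  assumes ab: "0 < \<alpha>" "0 < \<beta>" "\<alpha> + \<beta> = 1" "\<alpha> \<notin> \<rat>" and z: "in_dom b \<alpha> \<beta> z"
  shows "square_root (code b \<alpha> \<beta> z) = code b \<alpha> \<beta> (z / 2)"
proof -
  define X where "X z = (SOME x. shortest_square_prefix x (code b \<alpha> \<beta> z) \<and> (\<exists>t. code b \<alpha> \<beta> (z / 2) = x @- t))" for z
  define N where "N z = (rot b \<alpha> \<beta> ^^ (2 * length (X z))) z" for z
  define F where "F z = smap X (siterate N z)" for z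
  have X: "shortest_square_prefix (X z) (code b \<alpha> \<beta> z) \<and> (\<exists>t. code b \<alpha> \<beta> (z / 2) = X z @- t)"
    if "in_dom b \<alpha> \<beta> z" for z
  proof -
    have "\<exists>x. shortest_square_prefix x (code b \<alpha> \<beta> z) \<and> (\<exists>t. code b \<alpha> \<beta> (z / 2) = x @- t)"
      using sqrt_step[OF ab that] by blast
    then show ?thesis unfolding X_def by (rule someI_ex)
  qed
  have ne: "X z \<noteq> []" if "in_dom b \<alpha> \<beta> z" for z
    using X[OF that] unfolding shortest_square_prefix_def square_prefix_def by blast
  have N_dom: "in_dom b \<alpha> \<beta> (N z)" if "in_dom b \<alpha> \<beta> z" for z
    unfolding N_def by (intro in_dom_rot_funpow ab that)
  have square: "code b \<alpha> \<beta> z = X z @- X z @- code b \<alpha> \<beta> (N z)" if "in_dom b \<alpha> \<beta> z" for z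
    using square_prefix_shift X[OF that] unfolding N_def sdrop_code[symmetric] shortest_square_prefix_def by blast
  have root: "code b \<alpha> \<beta> (z / 2) = X z @- code b \<alpha> \<beta> (N z / 2)" if dom: "in_dom b \<alpha> \<beta> z" for z
  proof -
    obtain t where t: "code b \<alpha> \<beta> (z / 2) = X z @- t" using X[OF dom] by blast
    have "stake (length (X z)) (code b \<alpha> \<beta> (z / 2)) = X z"
      unfolding t by (simp add: stake_shift)
    moreover have "stake (2 * length (X z)) (code b \<alpha> \<beta> z) = X z @ X z"
      using arg_cong[OF square[OF dom], of "stake (2 * length (X z))"] by (simp add: stake_shift)
    \<comment> \<open>The word \<open>X z\<close> has half the letter counts of its square, so z / 2
      moves by half the displacement of \<open>z\<close>.\<close>
    ultimately have "(rot b \<alpha> \<beta> ^^ length (X z)) (z / 2) = N z / 2"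
      unfolding N_def rot_funpow by (simp add: field_simps)
    then have "sdrop (length (X z)) (code b \<alpha> \<beta> (z / 2)) = code b \<alpha> \<beta> (N z / 2)"
      by (simp only: sdrop_code)
    then show ?thesis unfolding t by (simp add: sdrop_shift)
  qed
  have F: "F z = X z ## F (N z)" for z
    unfolding F_def by (subst siterate.ctr) simp
  have F_sdrop: "sdrop n (F z) = F ((N ^^ n) z)" for n z
    by (simp add: F_def)
  have N_pow: "in_dom b \<alpha> \<beta> ((N ^^ n) z)" for n
    by (induction n) (simp_all add: z N_dom)
  have product: "square_product (F z) = code b \<alpha> \<beta> z" if "in_dom b \<alpha> \<beta> z" for z
  proof (rule shift_coinduct[where R = "\<lambda>x y. \<exists>z. in_dom b \<alpha> \<beta> z \<and> x = square_product (F z) \<and> y = code b \<alpha> \<beta> z"])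
    fix x y assume "\<exists>z. in_dom b \<alpha> \<beta> z \<and> x = square_product (F z) \<and> y = code b \<alpha> \<beta> z"
    then obtain z where z: "in_dom b \<alpha> \<beta> z" "x = square_product (F z)" "y = code b \<alpha> \<beta> z" by blast
    have "x = (X z @ X z) @- square_product (F (N z))"
      unfolding z(2) F[of z] using ne[OF z(1)] by (subst square_product_unfold) simp_all
    moreover have "y = (X z @ X z) @- code b \<alpha> \<beta> (N z)" using square[OF z(1)] z(3) by simp
    ultimately show "\<exists>w x' y'. w \<noteq> [] \<and> x = w @- x' \<and> y = w @- y' \<and>
        (\<exists>z. in_dom b \<alpha> \<beta> z \<and> x' = square_product (F z) \<and> y' = code b \<alpha> \<beta> z)"
      using N_dom[OF z(1)] ne[OF z(1)] by (intro exI[of _ "X z @ X z"]) blast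
  qed (use that in blast)
  have flat: "flat (F z) = code b \<alpha> \<beta> (z / 2)"
  proof (rule shift_coinduct[where R = "\<lambda>x y. \<exists>z. in_dom b \<alpha> \<beta> z \<and> x = flat (F z) \<and> y = code b \<alpha> \<beta> (z / 2)"])
    fix x y assume "\<exists>z. in_dom b \<alpha> \<beta> z \<and> x = flat (F z) \<and> y = code b \<alpha> \<beta> (z / 2)"
    then obtain z where z: "in_dom b \<alpha> \<beta> z" "x = flat (F z)" "y = code b \<alpha> \<beta> (z / 2)" by blast
    have "x = X z @- flat (F (N z))"
      unfolding z(2) F[of z] using ne[OF z(1)] by simp
    moreover have "y = X z @- code b \<alpha> \<beta> (N z / 2)" using root[OF z(1)] z(3) by simp
    ultimately show "\<exists>w x' y'. w \<noteq> [] \<and> x = w @- x' \<and> y = w @- y' \<and>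
        (\<exists>z. in_dom b \<alpha> \<beta> z \<and> x' = flat (F z) \<and> y' = code b \<alpha> \<beta> (z / 2))"
      using N_dom[OF z(1)] ne[OF z(1)] by blast
  qed (use z in blast)
  have "square_factorization (code b \<alpha> \<beta> z) (F z)"
    unfolding square_factorization_def F_sdrop product[OF N_pow] product[OF z]
    using ne[OF N_pow] X[OF N_pow] by (simp add: F_def)
  from square_root_eqI[OF this] flat show ?thesis by simp
qed


section \<open>Fixed points\<close>

lemma int_combination_eq_0:
  fixes \<alpha> \<beta> :: real and x y :: int
  assumes "\<alpha> + \<beta> = 1" "\<alpha> \<notin> \<rat>" "of_int x * \<alpha> + of_int y * \<beta> = 0"
  shows "x = 0 \<and> y = 0"
proof -
  have beta: "\<beta> = 1 - \<alpha>" using assms(1) by simp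
  have eq: "of_int (x - y) * \<alpha> = of_int (- y)"
    using assms(3) unfolding beta by (simp add: algebra_simps)
  have "x = y"
  proof (rule ccontr)
    assume "x \<noteq> y"
    then have "\<alpha> = of_int (- y) / of_int (x - y)" using eq by (simp add: field_simps)
    then show False using assms(2) by (metis Rats_divide Rats_of_int)
  qed
  then show ?thesis using eq by simp
qed

lemma code_inject_scaled:
  assumes ab: "0 < \<alpha>" "0 < \<beta>" "\<alpha> + \<beta> = 1" "\<alpha> \<notin> \<rat>" and x: "in_dom b \<alpha> \<beta> x"
    and ab': "0 < \<alpha>'" "0 < \<beta>'" and y: "in_dom b \<alpha>' \<beta>' y"
    and eq: "code b \<alpha> \<beta> x = code b \<alpha>' \<beta>' y"
  shows "\<alpha>' = (\<alpha>' + \<beta>') * \<alpha> \<and> \<beta>' = (\<alpha>' + \<beta>') * \<beta> \<and> y = (\<alpha>' + \<beta>') * x"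
proof -
  define c where "c = \<alpha>' + \<beta>'"
  have c: "0 < c" using ab' by (simp add: c_def)
  have "code b (\<alpha>' / c) (\<beta>' / c) (y / c) = code b \<alpha>' \<beta>' y"
    using code_scale[OF c, of b "\<alpha>' / c" "\<beta>' / c" "y / c"] c by simp
  moreover have "in_dom b (\<alpha>' / c) (\<beta>' / c) (y / c)"
    using in_dom_scale[OF c, of b "\<alpha>' / c" "\<beta>' / c" "y / c"] c y by simp
  moreover have "\<alpha>' / c + \<beta>' / c = 1" using c by (simp add: c_def flip: add_divide_distrib)
  ultimately have "\<alpha> = \<alpha>' / c \<and> x = y / c"
    using code_inject[OF ab x, of "\<alpha>' / c" "\<beta>' / c" "y / c"] ab' c eq by simp
  then have "\<alpha>' = c * \<alpha>" "y = c * x" using c by (simp_all add: field_simps)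
  moreover have "\<beta>' = c * \<beta>"
  proof -
    have "c * \<alpha> + c * \<beta> = c" using ab(3) by (metis distrib_left mult.right_neutral)
    then show ?thesis using \<open>\<alpha>' = c * \<alpha>\<close> unfolding c_def by linarith
  qed
  ultimately show ?thesis unfolding c_def by blast
qed

text \<open>The element \<open>z (\<mu> - 1)\<close> lies in the lattice spanned by \<open>\<alpha>\<close> and \<open>\<beta>\<close>, on which \<open>\<mu>\<close> acts by an
  integer matrix of determinant 1 and trace \<open>t\<close>. Since \<open>\<mu>\<^sup>2 = t \<mu> - 1\<close>, the quotient of
  \<open>\<mu>\<^sup>n - 1\<close> by \<open>\<mu> - 1\<close> equals \<open>(t + 1) \<mu>\<close> for \<open>n = 3\<close> and \<open>t \<mu> (1 + \<mu>)\<close> for \<open>n = 4\<close>, and one of these is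
  divisible by 2.\<close>

lemma even_translation:
  fixes \<alpha> \<beta> \<mu> z :: real and p q r s x y :: int
  assumes "\<alpha> \<noteq> 0" and det: "p * s = q * r + 1"
    and mu: "\<mu> * \<alpha> = s * \<alpha> - q * \<beta>" "\<mu> * \<beta> = p * \<beta> - r * \<alpha>"
    and z: "\<mu> * z - z = x * \<alpha> + y * \<beta>"
  shows "\<exists>n \<in> {3, 4 :: nat}. \<exists>(x :: int) (y :: int). \<mu> ^ n * z - z = 2 * (x * \<alpha> + y * \<beta>)"
proof -
  define t where "t = p + s"
  have "real_of_int p * real_of_int s = real_of_int q * real_of_int r + 1"
    using arg_cong[OF det, of real_of_int] by simp
  \<comment> \<open>The Cayley-Hamilton identity, evaluated at \<alpha>.\<close>
  moreover have "(\<mu>\<^sup>2 - of_int t * \<mu> + 1) * \<alpha> = (q * r - p * s + 1) * \<alpha>"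
  proof -
    have "\<mu>\<^sup>2 * \<alpha> = \<mu> * (\<mu> * \<alpha>)" by (simp add: power2_eq_square)
    also have "\<dots> = \<mu> * (s * \<alpha> - q * \<beta>)" by (simp only: mu(1))
    also have "\<dots> = s * (\<mu> * \<alpha>) - q * (\<mu> * \<beta>)" by (simp add: algebra_simps)
    also have "\<dots> = s * (s * \<alpha> - q * \<beta>) - q * (p * \<beta> - r * \<alpha>)" by (simp only: mu)
    finally have "(\<mu>\<^sup>2 - of_int t * \<mu> + 1) * \<alpha> =
        s * (s * \<alpha> - q * \<beta>) - q * (p * \<beta> - r * \<alpha>) - of_int t * (\<mu> * \<alpha>) + \<alpha>"
      by (simp add: distrib_right left_diff_distrib mult.assoc)
    then show ?thesis unfolding mu(1) t_def by (simp add: algebra_simps)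
  qed
  ultimately have "(\<mu>\<^sup>2 - of_int t * \<mu> + 1) * \<alpha> = 0" by simp
  then have mu2: "\<mu>\<^sup>2 = of_int t * \<mu> - 1" using assms(1) by simp
  have lattice: "\<mu> * (of_int x * \<alpha> + of_int y * \<beta>) = of_int (x * s - y * r) * \<alpha> + of_int (y * p - x * q) * \<beta>"
    for x y
  proof -
    have "\<mu> * (of_int x * \<alpha> + of_int y * \<beta>) = x * (\<mu> * \<alpha>) + y * (\<mu> * \<beta>)"
      by (simp add: algebra_simps)
    then show ?thesis unfolding mu by (simp add: algebra_simps)
  qed
  define x' y' where "x' = x * s - y * r" and "y' = y * p - x * q"
  have e: "\<mu> * (x * \<alpha> + y * \<beta>) = x' * \<alpha> + y' * \<beta>"
    unfolding x'_def y'_def by (rule lattice)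
  define x'' y'' where "x'' = x' * s - y' * r" and "y'' = y' * p - x' * q"
  have e': "\<mu> * (x' * \<alpha> + y' * \<beta>) = x'' * \<alpha> + y'' * \<beta>"
    unfolding x''_def y''_def by (rule lattice)
  show ?thesis
  proof (cases "even t")
    case False
    then obtain m where m: "t + 1 = 2 * m" by (metis odd_one odd_add evenE)
    then have m': "of_int t + 1 = 2 * real_of_int m" by (metis of_int_1 of_int_add of_int_mult of_int_numeral)
    have "\<mu> ^ 3 * z - z = (\<mu> * z - z) * (1 + \<mu> + \<mu>\<^sup>2)" by (simp add: power3_eq_cube power2_eq_square algebra_simps)
    also have "\<dots> = (of_int t + 1) * (\<mu> * (x * \<alpha> + y * \<beta>))" unfolding mu2 z by (simp add: algebra_simps)
    also have "\<dots> = 2 * (of_int (m * x') * \<alpha> + of_int (m * y') * \<beta>)"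
      unfolding m' e by (simp add: algebra_simps)
    finally show ?thesis by blast
  next
    case True
    then obtain m where m: "t = 2 * m" by (elim evenE)
    have "\<mu> ^ 4 * z - z = (\<mu> * z - z) * ((1 + \<mu>) * (1 + \<mu>\<^sup>2))"
      by (simp add: eval_nat_numeral algebra_simps)
    also have "\<dots> = 2 * of_int m * (\<mu> * (x * \<alpha> + y * \<beta>) + \<mu> * (\<mu> * (x * \<alpha> + y * \<beta>)))"
      unfolding mu2 z m by (simp add: algebra_simps)
    also have "\<dots> = 2 * (of_int (m * (x' + x'')) * \<alpha> + of_int (m * (y' + y'')) * \<beta>)"
      unfolding e e' by (simp add: algebra_simps)
    finally show ?thesis by blast
  qed
qed

text \<open>The conjugate sought is the one halfway between \<open>\<phi>\<close> and \<open>\<theta>\<close>: both halves of the even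
  translation \<open>v\<close> have the same effect on points, since two points of the domain whose difference is
  an integer coincide.\<close>

lemma halfway_conjugate:
  assumes ab: "0 < \<alpha>" "0 < \<beta>" "\<alpha> + \<beta> = 1" "\<alpha> \<notin> \<rat>" and z: "in_dom b \<alpha> \<beta> z"
    and phi: "\<phi> \<in> special_sturmian_monoid" "morph_stream \<phi> (code b \<alpha> \<beta> z) = code b \<alpha> \<beta> z"
    and theta: "\<theta> \<in> special_sturmian_monoid" "\<And>a. v @ \<theta> [a] = \<phi> [a] @ v"
    and act: "\<And>y. in_dom b \<alpha> \<beta> y \<Longrightarrow>
      in_dom b \<alpha> \<beta> (c * y) \<and> morph_stream \<theta> (code b \<alpha> \<beta> y) = code b \<alpha> \<beta> (c * y)"
    and even: "c * z - z = 2 * (of_int x * \<alpha> + of_int y * \<beta>)"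
  shows "\<exists>\<psi> \<in> special_sturmian_monoid.
    morph_stream \<psi> (code b \<alpha> \<beta> (z / 2)) = code b \<alpha> \<beta> (z / 2) \<and> conjugate \<psi> \<phi>"
proof -
  note hom = hom_special[OF phi(1)] hom_special[OF theta(1)]
  have u: "code b \<alpha> \<beta> z = v @- code b \<alpha> \<beta> (c * z)"
    using conjugation_stream[OF hom theta(2), of "code b \<alpha> \<beta> z"] phi(2) act[OF z] by simp
  have "stake (length v) (code b \<alpha> \<beta> z) = v"
    using arg_cong[OF u, of "stake (length v)"] by (simp add: stake_shift)
  have "code b \<alpha> \<beta> ((rot b \<alpha> \<beta> ^^ length v) z) = code b \<alpha> \<beta> (c * z)"
    unfolding sdrop_code[symmetric] by (subst u) (simp add: sdrop_shift)
  then have "(rot b \<alpha> \<beta> ^^ length v) z = c * z"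
    using code_inject[OF ab in_dom_rot_funpow[OF ab(1,2) z] ab(1-3)] act[OF z] by blast
  then have "c * z - z = \<alpha> * real (count_list v False) - \<beta> * real (count_list v True)"
    unfolding rot_funpow \<open>stake (length v) (code b \<alpha> \<beta> z) = v\<close> by simp
  then have "of_int (int (count_list v False) - 2 * x) * \<alpha> + of_int (- int (count_list v True) - 2 * y) * \<beta> = 0"
    using even by (simp add: algebra_simps)
  \<comment> \<open>Since \<alpha> and \<beta> are linearly independent over the integers, both
    letter counts of \<open>v\<close> are even; hence \<open>v\<close> has two halves of length
    \<open>j\<close>.\<close>
  from int_combination_eq_0[OF ab(3,4) this]
  have xy: "int (count_list v False) = 2 * x" "int (count_list v True) = - 2 * y" by auto
  have "length v = count_list v False + count_list v True"
    by (induction v) auto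
  then have len: "int (length v) = 2 * (x - y)" using xy by simp
  define j where "j = nat (x - y)"
  have "0 \<le> x - y" using len by presburger
  then have "int j = x - y" by (simp add: j_def)
  moreover from this have "length v = 2 * j" using len by presburger
  ultimately have j: "int j = x - y" "length v = 2 * j" by blast+
  define v1 v2 where "v1 = take j v" and "v2 = drop j v"
  have v12: "v = v1 @ v2" "length v2 = j" using j(2) by (simp_all add: v1_def v2_def)
  obtain \<psi> where psi: "\<psi> \<in> special_sturmian_monoid" "\<And>a. v2 @ \<theta> [a] = \<psi> [a] @ v2" "\<And>a. v1 @ \<psi> [a] = \<phi> [a] @ v1"
    using intermediate_conjugate[OF phi(1), of v1 v2 \<theta>] theta(2) unfolding v12(1) by blast
  have z2: "in_dom b \<alpha> \<beta> (z / 2)" using in_dom_half[OF ab(1,2) z] .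
  note cz2 = act[OF z2]
  have img: "morph_stream \<psi> (code b \<alpha> \<beta> (z / 2)) = v2 @- code b \<alpha> \<beta> (c * (z / 2))"
    using conjugation_stream[OF hom_special[OF psi(1)] hom(2) psi(2), of "code b \<alpha> \<beta> (z / 2)"] cz2 by simp
  \<comment> \<open>The image of the coding of z / 2 is a coding with unknown lengths. It ends in
    the coding of c (z / 2), so the lengths are proportional to \<alpha> and \<beta>; rescaling by
    \<open>d\<close> gives a point \<open>y0\<close> of the original domain.\<close>
  obtain \<alpha>' \<beta>' y' where img': "0 < \<alpha>'" "0 < \<beta>'" "in_dom b \<alpha>' \<beta>' y'"
    "morph_stream \<psi> (code b \<alpha> \<beta> (z / 2)) = code b \<alpha>' \<beta>' y'"
    using special_code[OF psi(1) ab(1,2) z2] by blast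
  have "code b \<alpha> \<beta> (c * (z / 2)) = sdrop j (code b \<alpha>' \<beta>' y')"
    unfolding img'(4)[symmetric] img using v12(2) by (simp add: sdrop_shift)
  then have "\<alpha>' = (\<alpha>' + \<beta>') * \<alpha> \<and> \<beta>' = (\<alpha>' + \<beta>') * \<beta>"
    using code_inject_scaled[OF ab conjunct1[OF cz2] img'(1,2) in_dom_rot_funpow[OF img'(1-3)]]
    unfolding sdrop_code by blast
  then obtain d where d: "0 < d" "\<alpha>' = d * \<alpha>" "\<beta>' = d * \<beta>"
    using add_pos_pos[OF img'(1,2)] by blast
  define y0 where "y0 = y' / d"
  have y': "y' = d * y0" using d(1) by (simp add: y0_def)
  have dom0: "in_dom b \<alpha> \<beta> y0" using img'(3) in_dom_scale[OF d(1)] unfolding d y' by simp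
  have img0: "morph_stream \<psi> (code b \<alpha> \<beta> (z / 2)) = code b \<alpha> \<beta> y0"
    unfolding img'(4) d(2,3) y' by (rule code_scale[OF d(1)])
  have "code b \<alpha> \<beta> ((rot b \<alpha> \<beta> ^^ j) y0) = code b \<alpha> \<beta> (c * (z / 2))"
    unfolding sdrop_code[symmetric] img0[symmetric] img using v12(2) by (simp add: sdrop_shift)
  then have "(rot b \<alpha> \<beta> ^^ j) y0 = c * (z / 2)"
    using code_inject[OF ab in_dom_rot_funpow[OF ab(1,2) dom0] ab(1-3)] cz2 by blast
  moreover define m where "m = count_list (stake j (code b \<alpha> \<beta> y0)) True"
  ultimately have "y0 + real j * \<alpha> - real m = c * (z / 2)"
    unfolding rot_funpow_normalized[OF ab(3)] by simp
  moreover have "c * (z / 2) - z / 2 = of_int x * \<alpha> + of_int y * \<beta>" using even by simp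
  moreover have "\<beta> = 1 - \<alpha>" using ab(3) by simp
  moreover have "real j = of_int x - of_int y" using arg_cong[OF j(1), of real_of_int] by simp
  \<comment> \<open>Modulo 1, both x \<alpha> + y \<beta> and \<open>j\<close> steps of the rotation
    are translations by j \<alpha>, because x - y = j.\<close>
  ultimately have diff: "y0 - z / 2 = of_int (y + int m)" by (simp add: algebra_simps)
  then have "\<bar>real_of_int (y + int m)\<bar> < 1" using in_dom_diff[OF dom0 z2] ab(3) by simp
  then have "y + int m = 0" by linarith
  then have "y0 = z / 2" using diff by simp
  moreover have "conjugate \<psi> \<phi>"
    unfolding conjugate_def right_conjugate_def using psi(3) by blast
  ultimately show ?thesis using psi(1) img0 by blast
qed

theorem theorem25:
  fixes u :: "bool stream" and \<phi> :: "bool list \<Rightarrow> bool list"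
  assumes "sturmian u"
    and "\<phi> \<in> special_sturmian_monoid"
    and "primitive_morphism \<phi>"
    and "fixes_seq \<phi> u"
  shows "\<exists>\<psi> \<in> special_sturmian_monoid. fixes_seq \<psi> (square_root u) \<and>
    (conjugate \<psi> \<phi> \<or> conjugate \<psi> (\<phi> ^^ 2) \<or> conjugate \<psi> (\<phi> ^^ 3) \<or> conjugate \<psi> (\<phi> ^^ 4))"
proof -
  obtain b \<alpha> z where alpha: "0 < \<alpha>" "\<alpha> < 1" "\<alpha> \<notin> \<rat>"
    and z: "in_dom b \<alpha> (1 - \<alpha>) z" and u: "u = code b \<alpha> (1 - \<alpha>) z"
    using sturmian_code[OF assms(1)] by blast
  define \<beta> where "\<beta> = 1 - \<alpha>"
  have ab: "0 < \<alpha>" "0 < \<beta>" "\<alpha> + \<beta> = 1" "\<alpha> \<notin> \<rat>" using alpha by (simp_all add: \<beta>_def)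
  note z = z[folded \<beta>_def] and u = u[folded \<beta>_def]
  have fixed: "morph_stream \<phi> u = u" using assms(4) by (simp add: fixes_seq_def)
  obtain \<theta> w and p q r s :: nat where theta: "\<theta> \<in> special_sturmian_monoid"
    and det: "p * s = q * r + (1 :: nat)" and conj: "\<And>a. w @ \<theta> [a] = \<phi> [a] @ w"
    and act: "\<And>b \<alpha> \<beta> z. 0 < \<alpha> \<Longrightarrow> 0 < \<beta> \<Longrightarrow> in_dom b \<alpha> \<beta> z \<Longrightarrow>
       morph_stream \<theta> (code b \<alpha> \<beta> z) = code b (real p * \<alpha> + real q * \<beta>) (real r * \<alpha> + real s * \<beta>) z"
    using special_normal_form[OF assms(2)] by blast
  note hom = hom_special[OF assms(2)] hom_special[OF theta]
  define \<alpha>' \<beta>' where "\<alpha>' = real p * \<alpha> + real q * \<beta>" and "\<beta>' = real r * \<alpha> + real s * \<beta>"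
  have "p * s \<noteq> 0" using det by simp
  then have "p \<noteq> 0" "s \<noteq> 0" by simp_all
  then have ge: "\<alpha> \<le> \<alpha>'" "\<beta> \<le> \<beta>'"
    using ab(1,2) mult_right_mono[of 1 "real p" \<alpha>] mult_right_mono[of 1 "real s" \<beta>]
    unfolding \<alpha>'_def \<beta>'_def by (auto intro: add_increasing add_increasing2)
  have ab': "0 < \<alpha>'" "0 < \<beta>'" using ge ab by linarith+
  define \<Lambda> where "\<Lambda> = \<alpha>' + \<beta>'"
  have Lam: "0 < \<Lambda>" using ab' by (simp add: \<Lambda>_def)
  have act': "morph_stream \<theta> (code b \<alpha> \<beta> y) = code b \<alpha>' \<beta>' y" "in_dom b \<alpha>' \<beta>' y"
    if "in_dom b \<alpha> \<beta> y" for y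
    using act[OF ab(1,2) that] in_dom_mono[OF that ge] unfolding \<alpha>'_def \<beta>'_def by blast+
  have "u = w @- code b \<alpha>' \<beta>' z"
    using conjugation_stream[OF hom conj, of u] fixed act'(1)[OF z] u by simp
  then have "code b \<alpha> \<beta> ((rot b \<alpha> \<beta> ^^ length w) z) = code b \<alpha>' \<beta>' z"
    unfolding sdrop_code[symmetric] u[symmetric] by (simp add: sdrop_shift)
  \<comment> \<open>Both sides code the same sequence, so the lengths are proportional: \<alpha> and
    \<beta> form an eigenvector of the matrix of \<open>\<theta>\<close> with eigenvalue
    \<Lambda>.\<close>
  from code_inject_scaled[OF ab in_dom_rot_funpow[OF ab(1,2) z] ab' act'(2)[OF z] this]
  have scale: "\<alpha>' = \<Lambda> * \<alpha>" "\<beta>' = \<Lambda> * \<beta>" and wz: "z = \<Lambda> * (rot b \<alpha> \<beta> ^^ length w) z"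
    unfolding \<Lambda>_def by blast+
  \<comment> \<open>Once the lengths are rescaled to \<alpha> and \<beta>, \<open>\<theta>\<close>
    acts on points as multiplication by \<mu>.\<close>
  define \<mu> where "\<mu> = 1 / \<Lambda>"
  have mu_Lam: "\<mu> * \<Lambda> = 1" "\<Lambda> * (\<mu> * y) = y" "\<mu> * (\<Lambda> * y) = y" for y using Lam by (simp_all add: \<mu>_def)
  have act_mu: "in_dom b \<alpha> \<beta> (\<mu> * y) \<and> morph_stream \<theta> (code b \<alpha> \<beta> y) = code b \<alpha> \<beta> (\<mu> * y)"
    if "in_dom b \<alpha> \<beta> y" for y
    using act'[OF that] code_scale[OF Lam, of b \<alpha> \<beta> "\<mu> * y"] in_dom_scale[OF Lam, of b \<alpha> \<beta> "\<mu> * y"]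
    unfolding scale mu_Lam by simp
  have act_pow: "in_dom b \<alpha> \<beta> (\<mu> ^ n * y) \<and> morph_stream (\<theta> ^^ n) (code b \<alpha> \<beta> y) = code b \<alpha> \<beta> (\<mu> ^ n * y)"
    if "in_dom b \<alpha> \<beta> y" for n y
  proof (induction n)
    case 0
    then show ?case using that by (simp add: morph_stream_id[unfolded id_def])
  next
    case (Suc n)
    have "morph_stream (\<theta> ^^ Suc n) (code b \<alpha> \<beta> y) = morph_stream \<theta> (morph_stream (\<theta> ^^ n) (code b \<alpha> \<beta> y))"
      unfolding funpow.simps by (intro morph_stream_comp hom hom_special funpow_special theta)
    then show ?case
      using Suc act_mu[of "\<mu> ^ n * y"] unfolding power_Suc mult.assoc by (simp del: funpow.simps)
  qed
  have det': "int p * int s = int q * int r + 1" using arg_cong[OF det, of int] by simp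
  have det_real: "real p * real s = real q * real r + 1" using arg_cong[OF det, of real] by simp
  have eig: "\<Lambda> * \<alpha> = real p * \<alpha> + real q * \<beta>" "\<Lambda> * \<beta> = real r * \<alpha> + real s * \<beta>"
    using scale by (simp_all add: \<alpha>'_def \<beta>'_def)
  \<comment> \<open>The inverse of the matrix, integral since the determinant is 1, describes the
    action of \<mu> on \<alpha> and \<beta>.\<close>
  have "\<Lambda> * (real s * \<alpha> - real q * \<beta>) = \<alpha>"
  proof -
    have "\<Lambda> * (real s * \<alpha> - real q * \<beta>) = real s * (\<Lambda> * \<alpha>) - real q * (\<Lambda> * \<beta>)"
      by (simp add: algebra_simps)
    also have "\<dots> = (real p * real s - real q * real r) * \<alpha>"
      unfolding eig by (simp add: algebra_simps)
    finally show ?thesis by (simp add: det_real)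
  qed
  moreover have "\<Lambda> * (real p * \<beta> - real r * \<alpha>) = \<beta>"
  proof -
    have "\<Lambda> * (real p * \<beta> - real r * \<alpha>) = real p * (\<Lambda> * \<beta>) - real r * (\<Lambda> * \<alpha>)"
      by (simp add: algebra_simps)
    also have "\<dots> = (real p * real s - real q * real r) * \<beta>"
      unfolding eig by (simp add: algebra_simps)
    finally show ?thesis by (simp add: det_real)
  qed
  ultimately have mu: "\<mu> * \<alpha> = of_int (int s) * \<alpha> - of_int (int q) * \<beta>" "\<mu> * \<beta> = of_int (int p) * \<beta> - of_int (int r) * \<alpha>"
    unfolding of_int_of_nat_eq by (metis mu_Lam(3))+
  \<comment> \<open>Reading \<open>w\<close> leads from \<open>z\<close> to \<mu> z, so the letter
    counts of \<open>w\<close> give the coordinates of the translation.\<close>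
  have "\<mu> * z = (rot b \<alpha> \<beta> ^^ length w) z" by (subst wz) (rule mu_Lam(3))
  then have trans: "\<mu> * z - z = of_int (int (count_list (stake (length w) (code b \<alpha> \<beta> z)) False)) * \<alpha>
      + of_int (- int (count_list (stake (length w) (code b \<alpha> \<beta> z)) True)) * \<beta>"
    unfolding rot_funpow by simp
  from even_translation[OF _ det' mu trans] ab(1)
  obtain n and x y :: int where n: "n = 3 \<or> n = 4" and even: "\<mu> ^ n * z - z = 2 * (of_int x * \<alpha> + of_int y * \<beta>)"
    by auto
  obtain v where "\<And>x. v @ (\<theta> ^^ n) x = (\<phi> ^^ n) x @ v"
    using conjugation_funpow[OF hom(1), of w \<theta> n] conjugation_words[OF hom conj] by blast
  moreover have "morph_stream (\<phi> ^^ n) (code b \<alpha> \<beta> z) = code b \<alpha> \<beta> z"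
    using morph_stream_funpow_fixed[OF assms(2) fixed] u by simp
  ultimately obtain \<psi> where "\<psi> \<in> special_sturmian_monoid"
    "morph_stream \<psi> (code b \<alpha> \<beta> (z / 2)) = code b \<alpha> \<beta> (z / 2)" "conjugate \<psi> (\<phi> ^^ n)"
    using halfway_conjugate[OF ab z funpow_special[OF assms(2)] _ funpow_special[OF theta] _ act_pow even]
    by blast
  moreover have "square_root u = code b \<alpha> \<beta> (z / 2)" unfolding u by (rule square_root_code[OF ab z])
  ultimately show ?thesis using n unfolding fixes_seq_def by (intro bexI[of _ \<psi>]) auto
qed

end
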